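(* Let $q$ be a prime power and $n\ge1$, and let $k(GL(n,q)\tau)$ denote the number of $G^+(n,q)$-conjugacy classes in the coset $GL(n,q)\tau$. (1) $k(GL(n,q)\tau)\le 28\,q^{\lfloor n/2\rfloor}$ if $q$ is even. (2) $k(GL(n,q)\tau)\le 23\,q^{\lfloor n/2\rfloor}$ if $q$ is odd.
   Context: $G^+(n,q)=\langle GL(n,q),\tau\rangle$ is the split extension of $GL(n,q)$ by the involution $\tau$ acting as the inverse transpose automorphism: $\tau g\tau=(g')^{-1}$, where $g'$ is the transpose of $g$. *)

theory Defs
  imports
    "Jordan_Normal_Form.Matrix"
    "HOL-Algebra.Group_Action"
    "HOL-Library.Cardinality"
begin

definition GL :: "'a::field itself \<Rightarrow> nat \<Rightarrow> 'a mat monoid" where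
  "GL ty n = units_of (ring_mat ty n ())"

definition inv_transpose :: "'a::field itself \<Rightarrow> nat \<Rightarrow> 'a mat \<Rightarrow> 'a mat" where
  "inv_transpose ty n g = inv\<^bsub>GL ty n\<^esub> (transpose_mat g)"

text \<open>
  The semidirect product of \<open>G\<close> with the group of order two whose nontrivial element acts on \<open>G\<close>
  by the involutory automorphism \<open>\<sigma>\<close>. With \<open>\<tau> = (\<one>, True)\<close>, the pair \<open>(g, False)\<close> stands
  for \<open>g\<close> and \<open>(g, True)\<close> for \<open>g\<tau>\<close>, so that \<open>g\<tau> \<cdot> h = g \<sigma>(h) \<tau>\<close>.
\<close>
definition split_ext :: "('g, 'b) monoid_scheme \<Rightarrow> ('g \<Rightarrow> 'g) \<Rightarrow> ('g \<times> bool) monoid" where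
  "split_ext G \<sigma> =
     \<lparr> carrier = carrier G \<times> UNIV,
       monoid.mult = (\<lambda>(g, s) (h, t). (g \<otimes>\<^bsub>G\<^esub> (if s then \<sigma> h else h), s \<noteq> t)),
       one = (\<one>\<^bsub>G\<^esub>, False) \<rparr>"

definition GL_plus :: "'a::field itself \<Rightarrow> nat \<Rightarrow> ('a mat \<times> bool) monoid" where
  "GL_plus ty n = split_ext (GL ty n) (inv_transpose ty n)"

definition GL_embed :: "'a::field mat \<Rightarrow> 'a mat \<times> bool" where
  "GL_embed g = (g, False)"

definition tau :: "'a::field itself \<Rightarrow> nat \<Rightarrow> 'a mat \<times> bool" where
  "tau ty n = (1\<^sub>m n, True)"

definition GL_tau :: "'a::field itself \<Rightarrow> nat \<Rightarrow> ('a mat \<times> bool) set" where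
  "GL_tau ty n = (GL_embed ` carrier (GL ty n)) #>\<^bsub>GL_plus ty n\<^esub> tau ty n"

definition conj_classes :: "('g, 'b) monoid_scheme \<Rightarrow> 'g set \<Rightarrow> 'g set set" where
  "conj_classes G S = orbits G S (\<lambda>g x. g \<otimes>\<^bsub>G\<^esub> x \<otimes>\<^bsub>G\<^esub> inv\<^bsub>G\<^esub> g)"

definition k_GL_tau :: "'a::field itself \<Rightarrow> nat \<Rightarrow> nat" where
  "k_GL_tau ty n = card (conj_classes (GL_plus ty n) (GL_tau ty n))"


subsection \<open>Consistency of the definitions\<close>

lemma group_split_ext:
  assumes "group G" and hom: "\<sigma> \<in> hom G G"
    and inv: "\<And>x. x \<in> carrier G \<Longrightarrow> \<sigma> (\<sigma> x) = x"
  shows "group (split_ext G \<sigma>)"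
proof -
  interpret group G by fact
  interpret h: group_hom G G \<sigma>
    by unfold_locales (rule hom)
  have inv': "\<exists>y\<in>carrier (split_ext G \<sigma>). y \<otimes>\<^bsub>split_ext G \<sigma>\<^esub> x = \<one>\<^bsub>split_ext G \<sigma>\<^esub>"
    if x: "x \<in> carrier (split_ext G \<sigma>)" for x
  proof -
    obtain g s where gs: "x = (g, s)" and g: "g \<in> carrier G"
      using x by (auto simp: split_ext_def)
    show ?thesis
      by (rule bexI[where x = "(inv\<^bsub>G\<^esub> (if s then \<sigma> g else g), s)"])
        (use g gs in \<open>auto simp: split_ext_def\<close>)
  qed
  show ?thesis
    by (rule groupI)
      (use inv' in \<open>auto simp: split_ext_def inv m_assoc split: if_splits\<close>)
qed

lemma carrier_GL: "carrier (GL TYPE('a::field) n) = Units (ring_mat TYPE('a) n ())"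
  by (simp add: GL_def units_of_def)

lemma mult_GL: "x \<otimes>\<^bsub>GL TYPE('a::field) n\<^esub> y = x * y"
  by (simp add: GL_def units_of_def ring_mat_simps)

lemma one_GL: "\<one>\<^bsub>GL TYPE('a::field) n\<^esub> = 1\<^sub>m n"
  by (simp add: GL_def units_of_def ring_mat_simps)

lemma carrier_GL_iff:
  "g \<in> carrier (GL TYPE('a::field) n) \<longleftrightarrow> g \<in> carrier_mat n n \<and> invertible_mat g"
proof
  assume "g \<in> carrier (GL TYPE('a) n)"
  then obtain h where "g \<in> carrier_mat n n" "h \<in> carrier_mat n n" "h * g = 1\<^sub>m n" "g * h = 1\<^sub>m n"
    unfolding carrier_GL Units_def ring_mat_simps by blast
  then show "g \<in> carrier_mat n n \<and> invertible_mat g"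
    unfolding invertible_mat_def inverts_mat_def square_mat.simps by auto
next
  assume g: "g \<in> carrier_mat n n \<and> invertible_mat g"
  then obtain h where h: "g * h = 1\<^sub>m n" "h * g = 1\<^sub>m (dim_row h)"
    unfolding invertible_mat_def inverts_mat_def by auto
  have "dim_col h = n"
    using arg_cong[OF h(1), of dim_col] by simp
  moreover have "dim_row h = n"
    using arg_cong[OF h(2), of dim_col] g by auto
  ultimately show "g \<in> carrier (GL TYPE('a) n)"
    unfolding carrier_GL Units_def ring_mat_simps using g h by auto
qed

lemma group_GL: "group (GL TYPE('a::field) n)"
proof -
  interpret ring "ring_mat TYPE('a) n ()" by (rule ring_mat)
  show ?thesis unfolding GL_def by (rule units_group)
qed

lemma GL_transpose:
  assumes "g \<in> carrier (GL TYPE('a::field) n)"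
  shows "transpose_mat g \<in> carrier (GL TYPE('a) n)"
    and "inv\<^bsub>GL TYPE('a) n\<^esub> (transpose_mat g) = transpose_mat (inv\<^bsub>GL TYPE('a) n\<^esub> g)"
proof -
  interpret group "GL TYPE('a) n" by (rule group_GL)
  let ?i = "inv\<^bsub>GL TYPE('a) n\<^esub> g"
  have i: "?i \<in> carrier (GL TYPE('a) n)" using assms by simp
  have c: "g \<in> carrier_mat n n" "?i \<in> carrier_mat n n"
    using assms i by (auto simp: carrier_GL_iff)
  have eq: "?i * g = 1\<^sub>m n" "g * ?i = 1\<^sub>m n"
    using l_inv[OF assms] r_inv[OF assms] by (simp_all add: mult_GL one_GL)
  have t: "transpose_mat ?i * transpose_mat g = 1\<^sub>m n" "transpose_mat g * transpose_mat ?i = 1\<^sub>m n"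
    using arg_cong[OF eq(1), of transpose_mat] arg_cong[OF eq(2), of transpose_mat] c
    by (simp_all add: transpose_mult)
  show 1: "transpose_mat g \<in> carrier (GL TYPE('a) n)"
    unfolding carrier_GL Units_def ring_mat_simps using c t by auto
  have 2: "transpose_mat ?i \<in> carrier (GL TYPE('a) n)"
    unfolding carrier_GL Units_def ring_mat_simps using c t by auto
  show "inv\<^bsub>GL TYPE('a) n\<^esub> (transpose_mat g) = transpose_mat ?i"
    by (rule inv_equality) (use t 1 2 in \<open>auto simp: mult_GL one_GL\<close>)
qed

lemma inv_transpose_hom: "inv_transpose TYPE('a::field) n \<in> hom (GL TYPE('a) n) (GL TYPE('a) n)"
proof -
  interpret group "GL TYPE('a) n" by (rule group_GL)
  show ?thesis
  proof (rule homI)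
    fix x assume "x \<in> carrier (GL TYPE('a) n)"
    then show "inv_transpose TYPE('a) n x \<in> carrier (GL TYPE('a) n)"
      by (simp add: inv_transpose_def GL_transpose(1))
  next
    fix x y assume xy: "x \<in> carrier (GL TYPE('a) n)" "y \<in> carrier (GL TYPE('a) n)"
    then have c: "x \<in> carrier_mat n n" "y \<in> carrier_mat n n"
      by (auto simp: carrier_GL_iff)
    have "transpose_mat (x \<otimes>\<^bsub>GL TYPE('a) n\<^esub> y)
        = transpose_mat y \<otimes>\<^bsub>GL TYPE('a) n\<^esub> transpose_mat x"
      using c by (simp add: mult_GL transpose_mult)
    then show "inv_transpose TYPE('a) n (x \<otimes>\<^bsub>GL TYPE('a) n\<^esub> y)
        = inv_transpose TYPE('a) n x \<otimes>\<^bsub>GL TYPE('a) n\<^esub> inv_transpose TYPE('a) n y"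
      by (simp add: inv_transpose_def inv_mult_group GL_transpose(1) xy)
  qed
qed

lemma inv_transpose_involution:
  assumes "g \<in> carrier (GL TYPE('a::field) n)"
  shows "inv_transpose TYPE('a) n (inv_transpose TYPE('a) n g) = g"
proof -
  interpret group "GL TYPE('a) n" by (rule group_GL)
  show ?thesis using assms
    by (simp add: inv_transpose_def GL_transpose)
qed

lemma group_GL_plus: "group (GL_plus TYPE('a::field) n)"
  unfolding GL_plus_def
  by (rule group_split_ext[OF group_GL inv_transpose_hom inv_transpose_involution])

lemma tau_relations:
  "tau TYPE('a::field) n \<otimes>\<^bsub>GL_plus TYPE('a) n\<^esub> tau TYPE('a) n = \<one>\<^bsub>GL_plus TYPE('a) n\<^esub>"
  "g \<in> carrier (GL TYPE('a) n) \<Longrightarrow>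
    tau TYPE('a) n \<otimes>\<^bsub>GL_plus TYPE('a) n\<^esub> GL_embed g \<otimes>\<^bsub>GL_plus TYPE('a) n\<^esub> tau TYPE('a) n
      = GL_embed (inv\<^bsub>GL TYPE('a) n\<^esub> (transpose_mat g))"
proof -
  interpret group "GL TYPE('a) n" by (rule group_GL)
  have i: "inv_transpose TYPE('a) n (1\<^sub>m n) = 1\<^sub>m n"
    using inv_one by (simp add: inv_transpose_def one_GL)
  show "tau TYPE('a) n \<otimes>\<^bsub>GL_plus TYPE('a) n\<^esub> tau TYPE('a) n = \<one>\<^bsub>GL_plus TYPE('a) n\<^esub>"
    by (simp add: GL_plus_def split_ext_def tau_def mult_GL one_GL i)
  assume g: "g \<in> carrier (GL TYPE('a) n)"
  then have t: "inv_transpose TYPE('a) n g \<in> carrier (GL TYPE('a) n)"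
    by (simp add: inv_transpose_def GL_transpose(1))
  then have "inv_transpose TYPE('a) n g \<in> carrier_mat n n"
    by (auto simp: carrier_GL_iff)
  then show "tau TYPE('a) n \<otimes>\<^bsub>GL_plus TYPE('a) n\<^esub> GL_embed g \<otimes>\<^bsub>GL_plus TYPE('a) n\<^esub> tau TYPE('a) n
      = GL_embed (inv\<^bsub>GL TYPE('a) n\<^esub> (transpose_mat g))"
    by (simp add: GL_plus_def split_ext_def tau_def GL_embed_def mult_GL i flip: inv_transpose_def)
qed

lemma GL_tau_eq: "GL_tau TYPE('a::field) n = carrier (GL TYPE('a) n) \<times> {True}"
proof -
  have "g * 1\<^sub>m n = g" if "g \<in> carrier (GL TYPE('a) n)" for g
    using that by (auto simp: carrier_GL_iff)
  then show ?thesis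
    by (auto simp: GL_tau_def r_coset_def GL_plus_def split_ext_def tau_def GL_embed_def mult_GL)
qed

text \<open>The set of classes counted by \<open>k_GL_tau\<close> is finite, so its \<open>card\<close> is not a junk value.\<close>

lemma finite_carrier_mat_finite: "finite (carrier_mat m n :: 'a::finite mat set)"
proof -
  let ?I = "{..<m} \<times> {..<n}"
  have "carrier_mat m n \<subseteq> mat m n ` (?I \<rightarrow>\<^sub>E (UNIV :: 'a set))"
  proof
    fix A :: "'a mat" assume "A \<in> carrier_mat m n"
    then have "A = mat m n (restrict (\<lambda>ij. A $$ ij) ?I)"
      by (intro eq_matI) auto
    moreover have "restrict (\<lambda>ij. A $$ ij) ?I \<in> ?I \<rightarrow>\<^sub>E UNIV"
      by simp
    ultimately show "A \<in> mat m n ` (?I \<rightarrow>\<^sub>E UNIV)"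
      by blast
  qed
  then show ?thesis
    by (rule finite_subset) (auto intro!: finite_PiE)
qed

lemma finite_conj_classes_GL_tau:
  "finite (conj_classes (GL_plus TYPE('a::{field,finite}) n) (GL_tau TYPE('a) n))"
proof -
  have "finite (carrier (GL TYPE('a) n))"
    by (rule finite_subset[OF _ finite_carrier_mat_finite[of n n]]) (auto simp: carrier_GL_iff)
  then have "finite (GL_tau TYPE('a) n)"
    by (simp add: GL_tau_eq)
  then show ?thesis
    unfolding conj_classes_def orbits_def Setcompr_eq_image by (rule finite_imageI)
qed

end

theory Submission
  imports Defs "HOL-Computational_Algebra.Polynomial_Factorial" Complex_Main
begin

text \<open>
  The classes in the coset are the congruence classes \<open>x \<mapsto> g x g'\<close> of invertible matrices. By Burnside's
  lemma, applied to this action and to conjugation, their number is at most the number of conjugacy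
  classes of those \<open>g \<in> GL(n, q)\<close> that preserve a nondegenerate bilinear form. For such \<open>g\<close> the inverse
  is the adjoint, so \<open>f(g)\<close> and \<open>f(g\<^sup>-\<^sup>1)\<close> have kernels of the same size for all polynomials \<open>f\<close>.
  Splitting off cyclic summands of maximal order one by one, this symmetry passes to the complements,
  and hence all invariant factors of \<open>g\<close> are self-reciprocal.

  Quotients of consecutive invariant factors turn a chain into a sequence \<open>g\<^sub>1, g\<^sub>2, \<dots>\<close> of self-reciprocal
  polynomials with \<open>\<Sum> j deg g\<^sub>j = n\<close>. There are about \<open>q\<^bsup>\<lfloor>d/2\<rfloor>\<^esup>\<close> of these of degree \<open>d\<close>, so \<open>g\<^sub>1\<close> accounts for
  \<open>q\<^bsup>\<lfloor>n/2\<rfloor>\<^esup>\<close> and the others contribute a convergent product, which is largest for \<open>q = 2\<close> resp. \<open>q = 3\<close>.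
\<close>

section \<open>Polynomials over a field\<close>

text \<open>Congruence classes are hard to classify directly. Exchanging the roles of the form
  \<open>x\<close> and the isometry \<open>g\<close> replaces them by similarity classes, which the
  cyclic decomposition separates. As only an upper bound is wanted, it is enough that equal chains
  force similarity; which chains occur is left open. The invariant form is given up once it has
  produced the kernel symmetry: it may degenerate on the complement of a cyclic summand, whereas
  numbers of kernel elements multiply over direct sums and can be divided out. The constants arise
  as 28 = 1 * 28 and 23 = 2 * (23/2). The first factor bounds the choices of the first quotient
  relative to the power of q and doubles for odd q, where two constant terms are possible. The
  second bounds the product over all further indices.\<close>

lemma ex_irreducible_factor:
  fixes f :: "'a::field poly"
  assumes "degree f > 0"
  shows "\<exists>p. irreducible p \<and> p dvd f \<and> degree p > 0"
  using assms
proof (induction "degree f" arbitrary: f rule: less_induct)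
  case less
  show ?case
  proof (cases "irreducible f")
    case True
    then show ?thesis using less.prems by auto
  next
    case False
    moreover have "f \<noteq> 0" using less.prems by auto
    moreover from this have "\<not> is_unit f" using less.prems by (simp add: is_unit_iff_degree)
    ultimately obtain a b where ab: "f = a * b" "\<not> is_unit a" "\<not> is_unit b"
      by (auto simp: irreducible_def)
    then have nz: "a \<noteq> 0" "b \<noteq> 0" using \<open>f \<noteq> 0\<close> by auto
    then have "degree f = degree a + degree b" "degree a > 0" "degree b > 0"
      using ab by (auto simp: degree_mult_eq is_unit_iff_degree)
    then obtain p where "irreducible p" "p dvd a" "degree p > 0" using less.hyps[of a] by auto
    then show ?thesis using ab(1) by auto
  qed
qed

lemma prime_elem_power_dvd_mult_cancel:
  fixes p :: "'a::field poly"
  assumes "prime_elem p" and "\<not> p dvd g" and "p ^ b dvd g * h"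
  shows "p ^ b dvd h"
  using assms(3)
proof (induction b arbitrary: h)
  case (Suc b)
  have "p dvd g * h" using Suc.prems by (metis dvd_mult_left power_Suc)
  then obtain k where k: "h = p * k" using assms(1,2) by (metis dvdE prime_elem_dvd_multD)
  have "p * p ^ b dvd p * (g * k)" using Suc.prems k by (simp add: mult.left_commute)
  moreover have "p \<noteq> 0" using assms(1) by (simp add: prime_elem_def)
  ultimately have "p ^ b dvd g * k" by (simp add: dvd_times_left_cancel_iff)
  then show ?case using Suc.IH[of k] k by (simp add: mult_dvd_mono)
qed simp

lemma prime_elem_power_mult_dvd:
  fixes p :: "'a::field poly"
  assumes "prime_elem p" and "\<not> p dvd g" and "p ^ b dvd h" and "g dvd h"
  shows "p ^ b * g dvd h"
proof -
  obtain k where k: "h = g * k" using assms(4) by blast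
  have "p ^ b dvd k"
    by (rule prime_elem_power_dvd_mult_cancel[OF assms(1,2)]) (use assms(3) k in simp)
  then show ?thesis using k by (simp add: mult.commute mult_dvd_mono)
qed

lemma power_decomposition:
  fixes g :: "'a::field poly"
  assumes "g \<noteq> 0" and "degree p > 0"
  shows "\<exists>a g'. g = p ^ a * g' \<and> \<not> p dvd g'"
  using assms(1)
proof (induction "degree g" arbitrary: g rule: less_induct)
  case less
  show ?case
  proof (cases "p dvd g")
    case False
    then show ?thesis by (intro exI[of _ 0] exI[of _ g]) simp
  next
    case True
    then obtain h where h: "g = p * h" by auto
    then have "h \<noteq> 0" "p \<noteq> 0" using less.prems by auto
    then have "degree h < degree g" using h assms(2) by (simp add: degree_mult_eq)
    then obtain a g' where "h = p ^ a * g'" "\<not> p dvd g'" using less.hyps \<open>h \<noteq> 0\<close> by blast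
    then show ?thesis using h by (intro exI[of _ "Suc a"] exI[of _ g']) (simp add: mult.assoc)
  qed
qed

text \<open>Supplies the prime at which one order exceeds another in the search for a vector of
  maximal order. The induction removes a full prime power from \<open>f\<close>: if that power
  divides \<open>g\<close>, the failure must lie in the coprime cofactor.\<close>

lemma prime_power_not_dvd:
  fixes f g :: "'a::field poly"
  assumes "f \<noteq> 0" and "\<not> f dvd g"
  shows "\<exists>p b. prime_elem p \<and> degree p > 0 \<and> p ^ b dvd f \<and> \<not> p ^ b dvd g"
  using assms
proof (induction "degree f" arbitrary: f rule: less_induct)
  case less
  have "degree f > 0" using less.prems is_unit_iff_degree[of f] unit_imp_dvd by auto
  then obtain p where p: "irreducible p" "p dvd f" "degree p > 0"
    using ex_irreducible_factor by blast
  have prime: "prime_elem p" by (rule field_poly_irreducible_imp_prime) fact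
  obtain b f' where f': "f = p ^ b * f'" "\<not> p dvd f'"
    using power_decomposition[OF less.prems(1) p(3)] by blast
  have "b > 0" using f' p(2) by (cases b) auto
  show ?case
  proof (cases "p ^ b dvd g")
    case False
    then show ?thesis using prime p(3) f'(1) by (meson dvd_triv_left)
  next
    case True
    have "\<not> f' dvd g"
      using prime_elem_power_mult_dvd[OF prime f'(2) True] less.prems(2) f'(1) by auto
    moreover have "f' \<noteq> 0" "p \<noteq> 0" using less.prems(1) f' p(3) by auto
    moreover have "degree f' < degree f"
      using f'(1) \<open>f' \<noteq> 0\<close> \<open>p \<noteq> 0\<close> \<open>b > 0\<close> p(3) by (simp add: degree_mult_eq degree_power_eq)
    ultimately obtain r c where rc: "prime_elem r" "degree r > 0" "r ^ c dvd f'" "\<not> r ^ c dvd g"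
      using less.hyps by blast
    have "r ^ c dvd f" using rc(3) f'(1) by simp
    then show ?thesis using rc by blast
  qed
qed

text \<open>The coordinate space of dimension \<open>d\<close>. Phrasing it by coefficients instead
  of the degree keeps 0 in it even for \<open>d = 0\<close> and makes the closure properties
  immediate.\<close>

definition polys_below :: "nat \<Rightarrow> 'a::zero poly set" where
  "polys_below d = {p. \<forall>i\<ge>d. coeff p i = 0}"

lemma polys_below_iff: "p \<in> polys_below d \<longleftrightarrow> p = 0 \<or> degree p < d"
proof
  assume p: "p \<in> polys_below d"
  show "p = 0 \<or> degree p < d"
  proof (cases "d \<le> degree p")
    case True
    then have "lead_coeff p = 0" using p unfolding polys_below_def by simp
    then show ?thesis by simp
  qed simp
next
  assume "p = 0 \<or> degree p < d"
  then show "p \<in> polys_below d" unfolding polys_below_def by (auto simp: coeff_eq_0)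
qed

lemma polys_below_add: "p \<in> polys_below d \<Longrightarrow> q \<in> polys_below d \<Longrightarrow> p + q \<in> polys_below d"
  by (simp add: polys_below_def)

lemma polys_below_diff:
  fixes p :: "'a::ab_group_add poly"
  shows "p \<in> polys_below d \<Longrightarrow> q \<in> polys_below d \<Longrightarrow> p - q \<in> polys_below d"
  by (simp add: polys_below_def)

lemma polys_below_smult: "p \<in> polys_below d \<Longrightarrow> smult c p \<in> polys_below d"
  by (simp add: polys_below_def)

lemma mod_in_polys_below:
  fixes m :: "'a::field poly"
  assumes "m \<noteq> 0"
  shows "p mod m \<in> polys_below (degree m)"
  using degree_mod_less[of m p] assms by (auto simp: polys_below_iff)

lemma polys_below_dvd_imp_0:
  fixes m :: "'a::field poly"
  assumes "m dvd p" and "p \<in> polys_below (degree m)"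
  shows "p = 0"
  using dvd_imp_degree_le[OF assms(1)] assms(2) polys_below_iff[of p "degree m"] by fastforce

lemma bij_betw_coeff_polys_below:
  "bij_betw (\<lambda>p. restrict (coeff p) {..<d}) (polys_below d) ({..<d} \<rightarrow>\<^sub>E (UNIV :: 'a::zero set))"
proof -
  let ?f = "\<lambda>g::nat \<Rightarrow> 'a. Abs_poly (\<lambda>i. if i < d then g i else 0)"
  have c: "coeff (?f g) i = (if i < d then g i else 0)" for g i
    by (subst Abs_poly_inverse) (auto simp: MOST_nat intro: exI[of _ d])
  show ?thesis
  proof (rule bij_betwI[where g = ?f])
    show "?f \<in> ({..<d} \<rightarrow>\<^sub>E UNIV) \<rightarrow> polys_below d"
      by (auto simp: polys_below_def c)
    show "(\<lambda>p. restrict (coeff p) {..<d}) \<in> polys_below d \<rightarrow> {..<d} \<rightarrow>\<^sub>E UNIV" by auto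
    show "restrict (coeff (?f g)) {..<d} = g" if "g \<in> {..<d} \<rightarrow>\<^sub>E UNIV" for g
      using that by (auto simp: c fun_eq_iff PiE_def extensional_def)
    show "?f (restrict (coeff p) {..<d}) = p" if "p \<in> polys_below d" for p
      using that by (auto simp: poly_eq_iff c polys_below_def)
  qed
qed

lemma finite_polys_below: "finite (polys_below d :: 'a::{zero,finite} poly set)"
  using bij_betw_finite[OF bij_betw_coeff_polys_below[where 'a = 'a]] by (simp add: finite_PiE)

lemma card_polys_below: "card (polys_below d :: 'a::zero poly set) = CARD('a) ^ d"
  using bij_betw_same_card[OF bij_betw_coeff_polys_below[where 'a = 'a]] by (simp add: card_PiE)

section \<open>Modules of linear operators\<close>

locale endomorphism = vector_space scale
  for scale :: "'a::field \<Rightarrow> 'b::ab_group_add \<Rightarrow> 'b" +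
  fixes T :: "'b \<Rightarrow> 'b"
  assumes T_add: "T (x + y) = T x + T y"
    and T_scale: "T (scale a x) = scale a (T x)"
begin

lemma T_0 [simp]: "T 0 = 0"
  using T_add[of 0 0] by simp

text \<open>This is p(T) v, evaluated by Horner's rule; it turns the space into a module over the
  polynomial ring.\<close>

definition act :: "'a poly \<Rightarrow> 'b \<Rightarrow> 'b" where
  "act p v = fold_coeffs (\<lambda>a w. scale a v + T w) p 0"

lemma act_0 [simp]: "act 0 v = 0"
  by (simp add: act_def)

lemma act_pCons [simp]: "act (pCons a p) v = scale a v + T (act p v)"
  by (cases "p = 0 \<and> a = 0") (auto simp: act_def)

lemma act_1 [simp]: "act 1 v = v"
  by (simp add: one_pCons)

lemma act_add: "act (p + q) v = act p v + act q v"
  by (induction p q rule: poly_induct2) (simp_all add: T_add scale_left_distrib algebra_simps)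

lemma act_smult: "act (smult c p) v = scale c (act p v)"
  by (induction p) (simp_all add: T_scale scale_right_distrib)

lemma act_mult: "act (p * q) v = act p (act q v)"
  by (induction p) (simp_all add: act_add act_smult)

lemma act_vec_add: "act p (v + w) = act p v + act p w"
  by (induction p) (simp_all add: T_add scale_right_distrib algebra_simps)

lemma act_vec_scale: "act p (scale c v) = scale c (act p v)"
  by (induction p) (simp_all add: T_scale scale_right_distrib mult.commute)

lemma act_vec_0 [simp]: "act p 0 = 0"
  by (induction p) simp_all

lemma act_minus: "act (- p) v = - act p v"
  using act_smult[of "-1" p v] by simp

lemma act_diff: "act (p - q) v = act p v - act q v"
  using act_add[of p "- q" v] by (simp add: act_minus)

lemma act_vec_diff: "act p (v - w) = act p v - act p w"
  using act_vec_add[of p "v - w" w] by (simp add: algebra_simps)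

lemma act_commute: "act p (act q v) = act q (act p v)"
  by (metis act_mult mult.commute)

lemma act_dvd: "p dvd q \<Longrightarrow> act p v = 0 \<Longrightarrow> act q v = 0"
  by (auto simp: act_mult act_commute elim!: dvdE)

lemma act_sum: "act (sum f A) v = (\<Sum>i\<in>A. act (f i) v)"
  by (induction A rule: infinite_finite_induct) (simp_all add: act_add)

lemma act_monom: "act (monom c k) v = scale c ((T ^^ k) v)"
  by (induction k) (simp_all add: monom_0 monom_Suc T_scale)

lemma act_eq_sum: "act p v = (\<Sum>i\<le>degree p. scale (coeff p i) ((T ^^ i) v))"
  by (subst poly_as_sum_of_monoms[of p, symmetric]) (simp only: act_sum act_monom)

text \<open>Finiteness of the set stands in for finite dimension, so that pigeonhole and counting
  arguments apply.\<close>

definition stable :: "'b set \<Rightarrow> bool" where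
  "stable S \<longleftrightarrow> subspace S \<and> finite S \<and> T ` S \<subseteq> S"

lemma act_closed: "stable S \<Longrightarrow> v \<in> S \<Longrightarrow> act p v \<in> S"
  by (induction p) (auto simp: stable_def intro: subspace_0 subspace_add subspace_scale)

text \<open>The monic generator of the annihilator ideal of \<open>v\<close>; monicity makes it
  unique and excludes the zero ideal.\<close>

definition is_order :: "'a poly \<Rightarrow> 'b \<Rightarrow> bool" where
  "is_order m v \<longleftrightarrow> lead_coeff m = 1 \<and> (\<forall>p. act p v = 0 \<longleftrightarrow> m dvd p)"

lemma is_order_act_self: "is_order m v \<Longrightarrow> act m v = 0"
  by (simp add: is_order_def)

text \<open>The infinitely many monomials take only finitely many values on \<open>v\<close>, so two
  of them agree and their difference annihilates \<open>v\<close>. A nonzero annihilator of least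
  degree divides all others, by division with remainder.\<close>

lemma ex_order:
  assumes "stable S" "v \<in> S"
  shows "\<exists>m. is_order m v"
proof -
  have "infinite (range (\<lambda>n. monom (1::'a) n))"
    by (rule range_inj_infinite) (auto simp: inj_def monom_eq_iff')
  moreover have "(\<lambda>p. act p v) ` range (\<lambda>n. monom (1::'a) n) \<subseteq> S"
    using act_closed[OF assms] by auto
  ultimately have "\<not> inj_on (\<lambda>p. act p v) (range (\<lambda>n. monom (1::'a) n))"
    using assms(1) by (meson finite_imageD finite_subset stable_def)
  then obtain p q where "p \<noteq> q" "act p v = act q v" by (auto simp: inj_on_def)
  then have "p - q \<noteq> 0 \<and> act (p - q) v = 0" by (simp add: act_diff)
  then obtain m where m: "m \<noteq> 0" "act m v = 0"
    and min: "\<And>p. p \<noteq> 0 \<Longrightarrow> act p v = 0 \<Longrightarrow> degree m \<le> degree p"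
    using ex_has_least_nat[of "\<lambda>p. p \<noteq> 0 \<and> act p v = 0" "p - q" degree] by auto
  have dvd: "m dvd p" if "act p v = 0" for p
  proof -
    have "act (p mod m) v = act p v - act (p div m * m) v"
      by (simp add: act_diff[symmetric] minus_div_mult_eq_mod)
    also have "\<dots> = 0" using that m by (simp add: act_mult)
    finally have "p mod m = 0"
      using min[of "p mod m"] degree_mod_less[of m p] m(1) by (metis not_le)
    then show ?thesis by (simp add: mod_eq_0_iff_dvd)
  qed
  have "act p v = 0 \<longleftrightarrow> m dvd p" for p
    using dvd act_dvd[OF _ m(2)] by blast
  then have "is_order (smult (inverse (lead_coeff m)) m) v"
    unfolding is_order_def using m(1) by (simp add: smult_dvd_iff)
  then show ?thesis ..
qed

lemma is_order_factor:
  assumes "is_order (f * g) v" "lead_coeff f = 1"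
  shows "is_order g (act f v)"
proof -
  have "lead_coeff g = 1" using assms by (auto simp: is_order_def lead_coeff_mult)
  moreover have "act p (act f v) = 0 \<longleftrightarrow> g dvd p" for p
  proof -
    have "act p (act f v) = 0 \<longleftrightarrow> f * g dvd f * p"
      using assms(1) by (simp add: is_order_def act_mult[symmetric] mult.commute)
    also have "\<dots> \<longleftrightarrow> g dvd p" using assms(2) by (subst dvd_mult_cancel_left) auto
    finally show ?thesis .
  qed
  ultimately show ?thesis by (simp add: is_order_def)
qed

text \<open>Coprime orders multiply: if \<open>h\<close> kills \<open>u + v\<close>, then
  \<open>g * h\<close> kills \<open>v\<close> and hence \<open>u\<close>, so the prime power divides
  \<open>g * h\<close> and therefore \<open>h\<close>. Then \<open>h\<close> kills \<open>u\<close>,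
  and so \<open>v\<close> as well.\<close>

lemma is_order_add_prime_power:
  assumes u: "is_order (p ^ b) u" and v: "is_order g v" and "prime_elem p" "\<not> p dvd g"
  shows "is_order (p ^ b * g) (u + v)"
proof -
  have 1: "p ^ b dvd h \<and> g dvd h" if h: "act h (u + v) = 0" for h
  proof
    have "act (g * h) u + act (g * h) v = 0"
      using h by (simp add: act_mult flip: act_vec_add)
    moreover have "act (g * h) v = 0" using v by (simp add: is_order_def)
    ultimately have "p ^ b dvd g * h" using u by (simp add: is_order_def)
    then show ph: "p ^ b dvd h" by (rule prime_elem_power_dvd_mult_cancel[OF assms(3,4)])
    then have "act h u = 0" using u by (simp add: is_order_def)
    then show "g dvd h" using h v by (simp add: is_order_def act_vec_add)
  qed
  have "act h (u + v) = 0 \<longleftrightarrow> p ^ b * g dvd h" for h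
  proof
    show "p ^ b * g dvd h" if "act h (u + v) = 0"
      using 1[OF that] prime_elem_power_mult_dvd[OF assms(3,4)] by blast
    show "act h (u + v) = 0" if h: "p ^ b * g dvd h"
    proof -
      have "act h u = 0" "act h v = 0"
        using u v dvd_mult_left[OF h] dvd_mult_right[OF h] by (simp_all add: is_order_def)
      then show ?thesis by (simp add: act_vec_add)
    qed
  qed
  moreover have "lead_coeff (p ^ b * g) = 1" using u v by (simp add: is_order_def lead_coeff_mult)
  ultimately show ?thesis by (simp add: is_order_def)
qed

text \<open>A vector whose order has the largest degree works. If the order of some \<open>u\<close>
  did not divide it, a prime would occur in the former with an exponent b exceeding its exponent a
  in the latter; combining the prime part of \<open>u\<close> with the coprime part of
  \<open>v\<close> would then give an order of larger degree.\<close>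

lemma ex_maximal_order:
  assumes S: "stable S"
  shows "\<exists>v m. v \<in> S \<and> is_order m v \<and> (\<forall>s\<in>S. act m s = 0)"
proof -
  define od where "od = (\<lambda>v. SOME m. is_order m v)"
  have od: "is_order (od v) v" if "v \<in> S" for v
    unfolding od_def using ex_order[OF S that] by (rule someI_ex)
  have "S \<noteq> {}" "finite S" using S by (auto simp: stable_def dest: subspace_0)
  then obtain v where v: "v \<in> S" and "degree (od v) = (MAX u\<in>S. degree (od u))"
    using obtains_MAX[of S "\<lambda>u. degree (od u)"] by metis
  then have max: "degree (od u) \<le> degree (od v)" if "u \<in> S" for u
    using that \<open>finite S\<close> by simp
  have "od u dvd od v" if u: "u \<in> S" for u
  proof (rule ccontr)
    assume "\<not> od u dvd od v"
    moreover have nz: "od u \<noteq> 0" "od v \<noteq> 0" using od[OF u] od[OF v] by (auto simp: is_order_def)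
    ultimately obtain p b where p: "prime_elem p" "degree p > 0" "p ^ b dvd od u" "\<not> p ^ b dvd od v"
      using prime_power_not_dvd by blast
    \<comment> \<open>The prime is made monic, since the factors of an order must be monic to be
      orders themselves.\<close>
    define r where "r = smult (inverse (lead_coeff p)) p"
    have "p \<noteq> 0" using p(2) by auto
    then have r: "lead_coeff r = 1" "degree r = degree p" by (simp_all add: r_def)
    have rp: "r dvd x \<longleftrightarrow> p dvd x" for x using \<open>p \<noteq> 0\<close> by (simp add: r_def smult_dvd_iff)
    have prime: "prime_elem r"
      using p(1) r rp unfolding prime_elem_def by force
    have rpb: "r ^ b dvd x \<longleftrightarrow> p ^ b dvd x" for x
      using \<open>p \<noteq> 0\<close> by (simp add: r_def smult_power smult_dvd_iff)
    obtain a g where g: "od v = r ^ a * g" "\<not> r dvd g"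
      using power_decomposition[of "od v" r] nz r p(2) by auto
    obtain f where f: "od u = f * r ^ b" using p(3) rpb by (metis dvdE mult.commute)
    have "\<not> b \<le> a" using p(4) g(1) rpb[of "od v"] by (metis dvd_mult2 le_imp_power_dvd)
    then have "a < b" by simp
    have lr: "lead_coeff (r ^ k) = 1" for k using r(1) by (simp add: lead_coeff_power)
    have lf: "lead_coeff f = 1" using od[OF u] f lr by (auto simp: is_order_def lead_coeff_mult)
    have 1: "is_order (r ^ b) (act f u)" using od[OF u] f lf by (metis is_order_factor)
    have 2: "is_order g (act (r ^ a) v)" using od[OF v] g lr by (metis is_order_factor)
    have 3: "is_order (r ^ b * g) (act f u + act (r ^ a) v)" (is "is_order _ ?w")
      by (rule is_order_add_prime_power[OF 1 2 prime g(2)])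
    have w: "?w \<in> S" using S act_closed[OF S u] act_closed[OF S v] by (simp add: stable_def subspace_add)
    have "r ^ b * g dvd od ?w" using 3 is_order_act_self[OF od[OF w]] by (simp add: is_order_def)
    moreover have "g \<noteq> 0" "r \<noteq> 0" using g nz r by auto
    ultimately have "degree (r ^ b * g) \<le> degree (od ?w)"
      using od[OF w] by (intro dvd_imp_degree_le) (auto simp: is_order_def)
    also have "\<dots> \<le> degree (od v)" by (rule max[OF w])
    finally show False using g \<open>g \<noteq> 0\<close> \<open>r \<noteq> 0\<close> \<open>a < b\<close> p(2) r(2)
      by (simp add: degree_mult_eq degree_power_eq)
  qed
  then have "act (od v) u = 0" if "u \<in> S" for u
    using od[OF that] that by (simp add: is_order_def)
  then show ?thesis using od v by blast
qed

end

section \<open>Cyclic subspaces and their complements\<close>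

context endomorphism
begin

definition cyclic :: "'b \<Rightarrow> 'b set" where
  "cyclic v = range (\<lambda>p. act p v)"

lemma act_in_cyclic [simp]: "act p v \<in> cyclic v"
  by (simp add: cyclic_def)

lemma cyclicE: "c \<in> cyclic v \<Longrightarrow> (\<And>p. c = act p v \<Longrightarrow> thesis) \<Longrightarrow> thesis"
  by (auto simp: cyclic_def)

lemma cyclic_subset: "stable S \<Longrightarrow> v \<in> S \<Longrightarrow> cyclic v \<subseteq> S"
  by (auto simp: cyclic_def act_closed)

lemma subspace_cyclic: "subspace (cyclic v)"
proof (rule subspaceI)
  show "0 \<in> cyclic v" using act_in_cyclic[of 0 v] by simp
  show "x + y \<in> cyclic v" if "x \<in> cyclic v" "y \<in> cyclic v" for x y
    using that by (auto elim!: cyclicE simp flip: act_add)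
  show "scale c x \<in> cyclic v" if "x \<in> cyclic v" for c x
    using that by (auto elim!: cyclicE simp flip: act_smult)
qed

lemma act_mod_order:
  assumes "act m v = 0"
  shows "act (p mod m) v = act p v"
proof -
  have "act (p mod m) v = act p v - act (p div m * m) v"
    by (simp add: minus_div_mult_eq_mod flip: act_diff)
  then show ?thesis using assms by (simp add: act_mult)
qed

lemma inj_on_act:
  assumes "is_order m v"
  shows "inj_on (\<lambda>p. act p v) (polys_below (degree m))"
proof (rule inj_onI)
  fix p q assume pq: "p \<in> polys_below (degree m)" "q \<in> polys_below (degree m)"
    and "act p v = act q v"
  then have "act (p - q) v = 0" by (simp add: act_diff)
  then have "m dvd p - q" using assms by (simp add: is_order_def)
  then have "p - q = 0" using polys_below_diff[OF pq] by (rule polys_below_dvd_imp_0)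
  then show "p = q" by simp
qed

lemma bij_betw_act_cyclic:
  assumes m: "is_order m v"
  shows "bij_betw (\<lambda>p. act p v) (polys_below (degree m)) (cyclic v)"
proof -
  have "m \<noteq> 0" using m by (auto simp: is_order_def)
  have "act p v \<in> (\<lambda>p. act p v) ` polys_below (degree m)" for p
    using act_mod_order[OF is_order_act_self[OF m], of p] mod_in_polys_below[OF \<open>m \<noteq> 0\<close>, of p]
    by (metis image_eqI)
  then show ?thesis using inj_on_act[OF m] by (auto simp: bij_betw_def cyclic_def)
qed

end

lemma vector_space_poly: "vector_space (smult :: 'a::field \<Rightarrow> 'a poly \<Rightarrow> 'a poly)"
  by unfold_locales (simp_all add: smult_add_right smult_add_left)

lemma subspace_polys_below: "module.subspace smult (polys_below d :: 'a::field poly set)"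
proof -
  interpret vector_space "smult :: 'a \<Rightarrow> 'a poly \<Rightarrow> 'a poly" by (rule vector_space_poly)
  show ?thesis unfolding subspace_def by (auto simp: polys_below_def)
qed

text \<open>The complement is the common kernel of the functionals \<open>w \<mapsto> \<phi> (T\<^sup>i w)\<close>, where \<open>\<phi>\<close> picks
  the top coefficient on the cyclic subspace (Jacob's proof of the cyclic decomposition).\<close>

lemma (in endomorphism) cyclic_complement:
  assumes S: "stable S" and v: "v \<in> S" and m: "is_order m v"
    and ann: "\<And>s. s \<in> S \<Longrightarrow> act m s = 0"
  shows "\<exists>W. stable W \<and> W \<subseteq> S \<and> cyclic v \<inter> W = {0} \<and> (\<forall>s\<in>S. \<exists>c\<in>cyclic v. \<exists>w\<in>W. s = c + w)"
proof (cases "degree m = 0")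
  case True
  have "m \<noteq> 0" using m by (auto simp: is_order_def)
  then have "m dvd 1" using True is_unit_iff_degree by blast
  then have "act 1 v = 0" using m unfolding is_order_def by blast
  then have "cyclic v = {0}" by (simp add: cyclic_def)
  moreover have "0 \<in> S" using S by (auto simp: stable_def dest: subspace_0)
  ultimately show ?thesis using S by (intro exI[of _ S]) auto
next
  case False
  define d where "d = degree m"
  have "d > 0" using False by (simp add: d_def)
  have "m \<noteq> 0" using m by (auto simp: is_order_def)
  interpret P: vector_space "smult :: 'a \<Rightarrow> 'a poly \<Rightarrow> 'a poly" by (rule vector_space_poly)
  interpret pair: vector_space_pair "smult :: 'a \<Rightarrow> 'a poly \<Rightarrow> 'a poly" scale by unfold_locales
  have "Vector_Spaces.linear smult scale (\<lambda>p. act p v)"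
    by (simp add: Vector_Spaces.linear_iff act_add act_smult vector_space_poly vector_space_axioms)
  \<comment> \<open>A linear left inverse of the parametrization of the cyclic subspace extends its
    coordinates to the whole space.\<close>
  then obtain g where g: "Vector_Spaces.linear scale smult g"
    and g_act: "\<And>p. p \<in> polys_below d \<Longrightarrow> g (act p v) = p"
    using pair.linear_exists_left_inverse_on[OF _ subspace_polys_below inj_on_act[OF m]]
    unfolding d_def by blast
  define \<phi> where "\<phi> s = coeff (g s) (d - 1)" for s
  have g_add: "g (x + y) = g x + g y" and g_scale: "g (scale a x) = smult a (g x)" for x y a
    using g by (simp_all add: Vector_Spaces.linear_iff)
  have \<phi>_add: "\<phi> (x + y) = \<phi> x + \<phi> y" and \<phi>_scale: "\<phi> (scale a x) = a * \<phi> x" for x y a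
    by (simp_all add: \<phi>_def g_add g_scale)
  have \<phi>_0: "\<phi> 0 = 0" using \<phi>_scale[of 0 0] by simp
  have \<phi>_diff: "\<phi> (x - y) = \<phi> x - \<phi> y" for x y
    using \<phi>_add[of "x - y" y] by simp
  have \<phi>_sum: "\<phi> (sum f A) = (\<Sum>a\<in>A. \<phi> (f a))" for f and A :: "nat set"
    by (induction A rule: infinite_finite_induct) (simp_all add: \<phi>_add \<phi>_0)
  have \<phi>_act: "\<phi> (act p v) = coeff p (d - 1)" if "p \<in> polys_below d" for p
    using g_act[OF that] by (simp add: \<phi>_def)
  define W where "W = {w \<in> S. \<forall>p. \<phi> (act p w) = 0}"
  have subS: "subspace S" and finS: "finite S" and TS: "T ` S \<subseteq> S" using S by (auto simp: stable_def)
  have "subspace W" unfolding subspace_def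
    using subspace_0[OF subS] subspace_add[OF subS] subspace_scale[OF subS]
    by (auto simp: W_def \<phi>_0 act_vec_add \<phi>_add act_vec_scale \<phi>_scale)
  moreover have "T w \<in> W" if "w \<in> W" for w
  proof -
    have "act p (T w) = act (pCons 0 p) w" for p using act_commute[of p "[:0, 1:]" w] by simp
    then show ?thesis using that TS by (auto simp: W_def simp del: act_pCons)
  qed
  ultimately have W: "stable W" using finS by (auto simp: stable_def W_def)
  have int: "c = 0" if c: "c \<in> cyclic v" "c \<in> W" for c
  proof (rule ccontr)
    assume "c \<noteq> 0"
    obtain p where p: "p \<in> polys_below d" "c = act p v"
      using c(1) bij_betw_act_cyclic[OF m] unfolding bij_betw_def d_def by blast
    then have "p \<noteq> 0" using \<open>c \<noteq> 0\<close> by auto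
    then have deg: "degree p < d" using p(1) by (simp add: polys_below_iff)
    \<comment> \<open>Multiplying by a power of the variable moves the leading coefficient of
      \<open>p\<close> to position \<open>d - 1\<close>, the one that \<phi> reads.\<close>
    define r where "r = monom 1 (d - 1 - degree p) * p"
    have "r \<noteq> 0" "degree r = d - 1" using deg \<open>p \<noteq> 0\<close>
      by (auto simp: r_def degree_mult_eq degree_monom_eq)
    then have "\<phi> (act r v) = lead_coeff r" using \<open>d > 0\<close> by (subst \<phi>_act) (auto simp: polys_below_iff)
    moreover have "\<phi> (act r v) = 0" using c(2) p(2) by (simp add: W_def r_def act_mult)
    ultimately show False using \<open>r \<noteq> 0\<close> by simp
  qed
  \<comment> \<open>These d values already decide membership in \<open>W\<close>, because
    \<open>m\<close> kills \<open>S\<close> and every polynomial can be reduced modulo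
    \<open>m\<close>. So \<Phi> is injective on the cyclic subspace, which has as many elements as
    there are value vectors; hence it is also surjective, and every vector can be corrected into
    \<open>W\<close>.\<close>
  define \<Phi> where "\<Phi> s = (\<lambda>i\<in>{..<d}. \<phi> (act (monom 1 i) s))" for s
  have W_iff: "s \<in> W" if s: "s \<in> S" and z: "\<And>i. i < d \<Longrightarrow> \<phi> (act (monom 1 i) s) = 0" for s
  proof -
    have "\<phi> (act p s) = 0" for p
    proof -
      let ?r = "p mod m"
      have "act ?r s = act p s" using ann[OF s] by (rule act_mod_order)
      moreover have "\<phi> (act ?r s) = \<phi> (\<Sum>i\<le>degree ?r. scale (coeff ?r i) (act (monom 1 i) s))"
        by (subst act_eq_sum) (simp add: act_monom)
      moreover have "degree ?r < d" using degree_mod_less[OF \<open>m \<noteq> 0\<close>, of p] \<open>d > 0\<close>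
        by (auto simp: d_def)
      ultimately have "\<phi> (act p s) = (\<Sum>i\<le>degree ?r. coeff ?r i * \<phi> (act (monom 1 i) s))"
        by (metis (no_types, lifting) \<phi>_scale \<phi>_sum sum.cong)
      also have "\<dots> = 0"
        by (intro sum.neutral ballI) (use z \<open>degree ?r < d\<close> in auto)
      finally show ?thesis .
    qed
    then show ?thesis using s by (simp add: W_def)
  qed
  have fin: "finite (cyclic v)" using cyclic_subset[OF S v] finS by (rule finite_subset)
  have fin_below: "finite (polys_below d :: 'a poly set)"
    using fin bij_betw_finite[OF bij_betw_act_cyclic[OF m]] by (simp add: d_def)
  have "inj_on \<Phi> (cyclic v)"
  proof (rule inj_onI)
    fix x y assume xy: "x \<in> cyclic v" "y \<in> cyclic v" "\<Phi> x = \<Phi> y"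
    have "x - y \<in> cyclic v" using xy subspace_diff[OF subspace_cyclic] by blast
    moreover have "x - y \<in> W"
    proof (rule W_iff)
      show "x - y \<in> S" using \<open>x - y \<in> cyclic v\<close> cyclic_subset[OF S v] by blast
      show "\<phi> (act (monom 1 i) (x - y)) = 0" if "i < d" for i
        using fun_cong[OF xy(3), of i] that by (simp add: \<Phi>_def act_vec_diff \<phi>_diff)
    qed
    ultimately have "x - y = 0" by (rule int)
    then show "x = y" by simp
  qed
  have surj: "\<exists>c\<in>cyclic v. \<Phi> c = \<Phi> s" for s
  proof -
    have "card (\<Phi> ` cyclic v) = card (polys_below d :: 'a poly set)"
      using card_image[OF \<open>inj_on \<Phi> (cyclic v)\<close>] bij_betw_same_card[OF bij_betw_act_cyclic[OF m]]
      by (simp add: d_def)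
    moreover have "\<Phi> ` cyclic v \<subseteq> {..<d} \<rightarrow>\<^sub>E UNIV"
      by (intro image_subsetI) (simp add: \<Phi>_def restrict_PiE_iff)
    moreover have "card ({..<d} \<rightarrow>\<^sub>E (UNIV :: 'a set)) = card (polys_below d :: 'a poly set)"
      by (rule bij_betw_same_card[OF bij_betw_coeff_polys_below, symmetric])
    moreover have "finite ({..<d} \<rightarrow>\<^sub>E (UNIV :: 'a set))" 
      using fin_below bij_betw_finite[OF bij_betw_coeff_polys_below[where 'a = 'a and d = d]] by simp
    ultimately have "\<Phi> ` cyclic v = {..<d} \<rightarrow>\<^sub>E UNIV" by (simp add: card_subset_eq)
    moreover have "\<Phi> s \<in> {..<d} \<rightarrow>\<^sub>E UNIV" by (simp add: \<Phi>_def restrict_PiE_iff)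
    ultimately show ?thesis by (metis imageE)
  qed
  have "\<exists>c\<in>cyclic v. \<exists>w\<in>W. s = c + w" if s: "s \<in> S" for s
  proof -
    obtain c where c: "c \<in> cyclic v" "\<Phi> c = \<Phi> s" using surj by blast
    have "s - c \<in> W"
    proof (rule W_iff)
      show "s - c \<in> S" using s c(1) cyclic_subset[OF S v] subspace_diff[OF subS] by blast
      show "\<phi> (act (monom 1 i) (s - c)) = 0" if "i < d" for i
        using fun_cong[OF c(2), of i] that by (simp add: \<Phi>_def act_vec_diff \<phi>_diff)
    qed
    then show ?thesis using c(1) by (intro bexI[of _ c] bexI[of _ "s - c"]) auto
  qed
  moreover have "cyclic v \<inter> W = {0}"
    using int subspace_0[OF \<open>subspace W\<close>] subspace_0[OF subspace_cyclic[of v]] by blast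
  ultimately show ?thesis using W by (intro exI[of _ W]) (auto simp: W_def)
qed

section \<open>Self-reciprocal polynomials\<close>

text \<open>The roots are closed under inversion with multiplicity. The scalar has to be
  \<open>coeff m 0\<close>, as a comparison of leading coefficients of the two sides shows for monic
  \<open>m\<close>.\<close>

definition self_recip :: "'a::field poly \<Rightarrow> bool" where
  "self_recip m \<longleftrightarrow> lead_coeff m = 1 \<and> coeff m 0 \<noteq> 0 \<and> reflect_poly m = smult (coeff m 0) m"

lemma self_recip_nonzero: "self_recip m \<Longrightarrow> m \<noteq> 0"
  by (auto simp: self_recip_def)

lemma self_recip_1: "self_recip 1"
  by (simp add: self_recip_def)

lemma self_recip_mult: "self_recip a \<Longrightarrow> self_recip b \<Longrightarrow> self_recip (a * b)"
  by (auto simp: self_recip_def lead_coeff_mult coeff_mult_0 reflect_poly_mult mult.commute)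

lemma self_recip_quotient:
  assumes "self_recip (a * b)" and b: "self_recip b"
  shows "self_recip a"
proof -
  have c: "coeff a 0 \<noteq> 0" "lead_coeff a = 1" "b \<noteq> 0"
    using assms by (auto simp: self_recip_def coeff_mult_0 lead_coeff_mult)
  have "smult (coeff b 0) (reflect_poly a * b) = reflect_poly (a * b)"
    using b by (simp add: reflect_poly_mult self_recip_def)
  also have "\<dots> = smult (coeff b 0) (smult (coeff a 0) a * b)"
    using assms(1) by (simp add: self_recip_def coeff_mult_0 mult.commute)
  finally have "smult (inverse (coeff b 0)) (smult (coeff b 0) (reflect_poly a * b))
      = smult (inverse (coeff b 0)) (smult (coeff b 0) (smult (coeff a 0) a * b))" by (rule arg_cong)
  then have "reflect_poly a * b = smult (coeff a 0) a * b"
    using b by (simp only: smult_smult) (simp add: self_recip_def)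
  then have "reflect_poly a = smult (coeff a 0) a" using c(3) by (metis mult_right_cancel)
  then show ?thesis using c by (simp add: self_recip_def)
qed

text \<open>A nonzero constant term makes the reflected polynomial have the same degree, so the
  quotient is a scalar.\<close>

lemma self_recip_if_dvd_reflect:
  fixes m :: "'a::field poly"
  assumes "lead_coeff m = 1" "coeff m 0 \<noteq> 0" "m dvd reflect_poly m"
  shows "self_recip m"
proof -
  obtain c where c: "reflect_poly m = m * c" using assms(3) by blast
  have nz: "m \<noteq> 0" "c \<noteq> 0" using assms(1) c by auto
  then have "degree c = 0" using arg_cong[OF c, of degree] assms(2) by (simp add: degree_mult_eq)
  then obtain k where "c = [:k:]" by (rule degree_eq_zeroE)
  then have "reflect_poly m = smult k m" using c by simp
  moreover from this have "k = coeff m 0"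
  proof -
    have "coeff (reflect_poly m) (degree m) = coeff m 0"
      by (simp add: coeff_reflect_poly)
    then show ?thesis using \<open>reflect_poly m = smult k m\<close> assms(1) by simp
  qed
  ultimately show ?thesis using assms by (simp add: self_recip_def)
qed

section \<open>Operators with the kernel dimensions of their inverse\<close>

text \<open>The two operators are inverse to each other only on the sets singled out by
  \<open>inv_stable\<close>, not on the whole type: the operators of invertible matrices used later
  discard all high coefficients.\<close>

locale inverse_pair = vector_space scale + T: endomorphism scale T + U: endomorphism scale U
  for scale :: "'a::field \<Rightarrow> 'b::ab_group_add \<Rightarrow> 'b" and T U
begin

definition inv_stable :: "'b set \<Rightarrow> bool" where
  "inv_stable S \<longleftrightarrow> T.stable S \<and> U.stable S \<and> (\<forall>s\<in>S. U (T s) = s \<and> T (U s) = s)"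

text \<open>The trace left by an invariant form, in a shape that does not mention the form and
  passes to direct summands.\<close>

definition balanced :: "'b set \<Rightarrow> bool" where
  "balanced S \<longleftrightarrow> (\<forall>f. card {s\<in>S. T.act f s = 0} = card {s\<in>S. U.act f s = 0})"

text \<open>On a finite set the injective map \<open>T\<close> is onto, so every element of
  \<open>W\<close> is some \<open>T w\<close> with \<open>w\<close> in \<open>W\<close>, and
  \<open>U\<close> leads back into \<open>W\<close>.\<close>

lemma inv_stable_subset:
  assumes S: "inv_stable S" and W: "T.stable W" "W \<subseteq> S"
  shows "inv_stable W"
proof -
  have "inj_on T W" using S W(2) by (metis inj_onI inv_stable_def subset_eq)
  then have "T ` W = W" using W(1) by (intro endo_inj_surj) (auto simp: T.stable_def)
  moreover have "U (T w) = w" if "w \<in> W" for w using that S W(2) by (auto simp: inv_stable_def)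
  ultimately have "U ` W \<subseteq> W" by (metis image_subsetI imageE)
  then show ?thesis using S W by (auto simp: inv_stable_def T.stable_def U.stable_def)
qed

text \<open>The identity behind reciprocal polynomials: reflecting \<open>p\<close> of degree d
  gives x^d p(1/x), and \<open>U\<close> plays the part of 1/x.\<close>

lemma T_act_reflect:
  assumes S: "inv_stable S" and s: "s \<in> S"
  shows "T.act (reflect_poly p) s = (T ^^ degree p) (U.act p s)"
proof (induction p)
  case (pCons a p)
  show ?case
  proof (cases "p = 0")
    case False
    have "U.act p s \<in> S" using S s by (simp add: inv_stable_def U.act_closed)
    then have TU: "T (U (U.act p s)) = U.act p s" using S by (simp add: inv_stable_def)
    have T_pow_add: "(T ^^ k) (x + y) = (T ^^ k) x + (T ^^ k) y" for k x y
      by (induction k) (simp_all add: T.T_add)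
    have T_pow_scale: "(T ^^ k) (scale c x) = scale c ((T ^^ k) x)" for k c x
      by (induction k) (simp_all add: T.T_scale)
    have "(T ^^ degree (pCons a p)) (U.act (pCons a p) s)
        = scale a ((T ^^ Suc (degree p)) s) + (T ^^ degree p) (T (U (U.act p s)))"
      unfolding degree_pCons_eq[OF False] U.act_pCons T_pow_add T_pow_scale
      by (simp add: funpow_Suc_right del: funpow.simps)
    also have "\<dots> = T.act (monom a (Suc (degree p))) s + T.act (reflect_poly p) s"
      by (simp only: TU pCons.IH T.act_monom)
    also have "\<dots> = T.act (reflect_poly (pCons a p)) s"
      using False by (simp add: reflect_poly_pCons' T.act_add add.commute)
    finally show ?thesis by simp
  qed simp
qed simp

lemma funpow_T_eq_0:
  assumes S: "inv_stable S" and s: "s \<in> S"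
  shows "(T ^^ k) s = 0 \<longleftrightarrow> s = 0"
  using s
proof (induction k arbitrary: s)
  case (Suc k)
  have "T s \<in> S" and UT: "U (T s) = s" using S Suc.prems by (auto simp: inv_stable_def T.stable_def)
  then have "(T ^^ Suc k) s = 0 \<longleftrightarrow> T s = 0" using Suc.IH by (simp add: funpow_swap1)
  also have "\<dots> \<longleftrightarrow> s = 0" using UT by (metis T.T_0 U.T_0)
  finally show ?case .
qed simp

lemma T_act_reflect_eq_0_iff:
  assumes S: "inv_stable S" and s: "s \<in> S"
  shows "T.act (reflect_poly p) s = 0 \<longleftrightarrow> U.act p s = 0"
  using T_act_reflect[OF assms] funpow_T_eq_0[OF S U.act_closed] S s
  by (simp add: inv_stable_def)

text \<open>Balance forces the minimal polynomial to be self-reciprocal, as it kills \<open>T\<close> and \<open>U\<close> alike.\<close>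

lemma self_recip_annihilator:
  assumes S: "inv_stable S" "balanced S" and v: "v \<in> S" and m: "T.is_order m v"
    and ann: "\<And>s. s \<in> S \<Longrightarrow> T.act m s = 0"
  shows "self_recip m" and "\<And>s. s \<in> S \<Longrightarrow> U.act m s = 0"
proof -
  have fin: "finite S" using S by (simp add: inv_stable_def T.stable_def)
  have "card {s\<in>S. U.act m s = 0} = card {s\<in>S. T.act m s = 0}" using S(2) by (simp add: balanced_def)
  also have "{s\<in>S. T.act m s = 0} = S" using ann by blast
  finally have "{s\<in>S. U.act m s = 0} = S" using fin by (intro card_subset_eq) auto
  then show U: "U.act m s = 0" if "s \<in> S" for s using that by blast
  have "T.act (reflect_poly m) v = 0" using T_act_reflect_eq_0_iff[OF S(1) v] U[OF v] by simp
  then have dvd: "m dvd reflect_poly m" using m by (simp add: T.is_order_def)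
  have "m \<noteq> 0" using m by (auto simp: T.is_order_def)
  have "coeff m 0 \<noteq> 0"
  proof
    assume "coeff m 0 = 0"
    then obtain p where p: "m = pCons 0 p" by (cases m) auto
    have pv: "T.act p v \<in> S" using S v by (simp add: inv_stable_def T.act_closed)
    have "T (T.act p v) = 0" using T.is_order_act_self[OF m] p by simp
    then have "T.act p v = 0" using funpow_T_eq_0[OF S(1) pv, of 1] by simp
    then have "m dvd p" using m by (simp add: T.is_order_def)
    moreover have "p \<noteq> 0" using p \<open>m \<noteq> 0\<close> by auto
    ultimately have "degree m \<le> degree p" by (rule dvd_imp_degree_le)
    then show False using p \<open>p \<noteq> 0\<close> by simp
  qed
  then show "self_recip m" using m dvd by (intro self_recip_if_dvd_reflect) (auto simp: T.is_order_def)
qed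

text \<open>The order under \<open>U\<close> divides \<open>m\<close>, and its reflection kills
  \<open>v\<close> under \<open>T\<close>, hence is a multiple of \<open>m\<close>. So the degrees
  agree, and both polynomials are monic.\<close>

lemma U_is_order:
  assumes S: "inv_stable S" and v: "v \<in> S" and m: "T.is_order m v" and Um: "U.act m v = 0"
  shows "U.is_order m v"
proof -
  obtain m' where m': "U.is_order m' v" using U.ex_order[of S v] S v by (auto simp: inv_stable_def)
  then obtain c where c: "m = m' * c" using Um by (auto simp: U.is_order_def)
  have nz: "m \<noteq> 0" "m' \<noteq> 0" using m m' by (auto simp: T.is_order_def U.is_order_def)
  have "T.act (reflect_poly m') v = 0"
    using T_act_reflect_eq_0_iff[OF S v] U.is_order_act_self[OF m'] by simp
  then have "m dvd reflect_poly m'" using m by (simp add: T.is_order_def)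
  then have "degree m \<le> degree m'"
    using dvd_imp_degree_le[of m "reflect_poly m'"] degree_reflect_poly_le[of m'] nz by simp
  moreover have "c \<noteq> 0" using c nz by auto
  ultimately have "degree c = 0" using c nz by (simp add: degree_mult_eq)
  then obtain k where k: "c = [:k:]" by (rule degree_eq_zeroE)
  then have mk: "m = smult k m'" using c by simp
  moreover have "k = 1"
    using arg_cong[OF mk, of lead_coeff] m m' unfolding lead_coeff_smult T.is_order_def U.is_order_def by simp
  ultimately have "m = m'" by simp
  then show ?thesis using m' by simp
qed

text \<open>Both operators generate the same subspace from \<open>v\<close>, by inclusion and equal
  size. In the coordinates \<open>p\<close> of either one, the kernel of \<open>f\<close> is given
  by the same condition \<open>m dvd f * p\<close>.\<close>

lemma balanced_cyclic:
  assumes S: "inv_stable S" "v \<in> S" and m: "T.is_order m v" "U.is_order m v"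
  shows "balanced (T.cyclic v)"
proof -
  have st: "T.stable (T.cyclic v)"
  proof -
    have "T ` T.cyclic v \<subseteq> T.cyclic v"
    proof (intro image_subsetI)
      fix c assume "c \<in> T.cyclic v"
      then obtain p where "c = T.act p v" by (rule T.cyclicE)
      then have "T c = T.act (pCons 0 p) v" by simp
      then show "T c \<in> T.cyclic v" by (simp del: T.act_pCons)
    qed
    moreover have "T.cyclic v \<subseteq> S" using S by (auto simp: inv_stable_def T.cyclic_subset)
    ultimately show ?thesis
      using S T.subspace_cyclic by (auto simp: T.stable_def inv_stable_def intro: finite_subset)
  qed
  have "T.cyclic v \<subseteq> S" using S by (auto simp: inv_stable_def T.cyclic_subset)
  then have inv: "inv_stable (T.cyclic v)" using inv_stable_subset[OF S(1) st] by simp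
  let ?A = "polys_below (degree m)"
  have bij: "bij_betw (\<lambda>p. T.act p v) ?A (T.cyclic v)" "bij_betw (\<lambda>p. U.act p v) ?A (U.cyclic v)"
    using m by (simp_all add: T.bij_betw_act_cyclic U.bij_betw_act_cyclic)
  have "v \<in> T.cyclic v" using T.act_in_cyclic[of 1 v] by simp
  then have "U.cyclic v \<subseteq> T.cyclic v" using inv by (auto simp: inv_stable_def U.cyclic_subset)
  moreover have "card (U.cyclic v) = card (T.cyclic v)"
    using bij by (metis bij_betw_same_card)
  ultimately have eq: "U.cyclic v = T.cyclic v"
    using st by (intro card_subset_eq) (auto simp: T.stable_def)
  have kT: "bij_betw (\<lambda>p. T.act p v) {p\<in>?A. m dvd f * p} {c\<in>T.cyclic v. T.act f c = 0}" for f
    by (rule bij_betw_Collect[OF bij(1)]) (use m(1) in \<open>simp add: T.is_order_def T.act_mult flip: T.act_mult\<close>)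
  have kU: "bij_betw (\<lambda>p. U.act p v) {p\<in>?A. m dvd f * p} {c\<in>U.cyclic v. U.act f c = 0}" for f
    by (rule bij_betw_Collect[OF bij(2)]) (use m(2) in \<open>simp add: U.is_order_def flip: U.act_mult\<close>)
  show ?thesis unfolding balanced_def
    using bij_betw_same_card[OF kT] bij_betw_same_card[OF kU] eq by simp
qed

end

lemma card_kernel_direct_sum:
  fixes L :: "'b::ab_group_add \<Rightarrow> 'b"
  assumes L: "\<And>x y. L (x + y) = L x + L y"
    and C: "\<And>x y. x \<in> C \<Longrightarrow> y \<in> C \<Longrightarrow> x - y \<in> C" "\<And>x. x \<in> C \<Longrightarrow> L x \<in> C"
    and W: "\<And>x y. x \<in> W \<Longrightarrow> y \<in> W \<Longrightarrow> x - y \<in> W" "\<And>x. x \<in> W \<Longrightarrow> L x \<in> W"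
    and int: "C \<inter> W = {0}"
    and sum: "\<And>s. s \<in> S \<longleftrightarrow> (\<exists>c\<in>C. \<exists>w\<in>W. s = c + w)"
  shows "card {s\<in>S. L s = 0} = card {c\<in>C. L c = 0} * card {w\<in>W. L w = 0}"
proof -
  have uniq: "c = c' \<and> w = w'" if "c \<in> C" "c' \<in> C" "w \<in> W" "w' \<in> W" "c + w = c' + w'" for c c' w w'
  proof -
    have "c - c' = w' - w" using that(5) by (simp add: algebra_simps)
    moreover have "c - c' \<in> C" "w' - w \<in> W" using that C W by blast+
    ultimately have "c - c' = 0" using int by (metis IntI singletonD)
    then show ?thesis using \<open>c - c' = w' - w\<close> by simp
  qed
  have z: "0 \<in> C" "0 \<in> W" using int by auto
  have "bij_betw (\<lambda>(c, w). c + w) ({c\<in>C. L c = 0} \<times> {w\<in>W. L w = 0}) {s\<in>S. L s = 0}"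
  proof (rule bij_betw_imageI)
    show "inj_on (\<lambda>(c, w). c + w) ({c\<in>C. L c = 0} \<times> {w\<in>W. L w = 0})"
      using uniq by (auto simp: inj_on_def)
    show "(\<lambda>(c, w). c + w) ` ({c\<in>C. L c = 0} \<times> {w\<in>W. L w = 0}) = {s\<in>S. L s = 0}"
    proof (intro equalityI subsetI)
      fix s assume "s \<in> {s\<in>S. L s = 0}"
      then obtain c w where cw: "c \<in> C" "w \<in> W" "s = c + w" "L c + L w = 0 + 0" using sum L by auto
      then have "L c = 0 \<and> L w = 0" using uniq C(2) W(2) z by blast
      then show "s \<in> (\<lambda>(c, w). c + w) ` ({c\<in>C. L c = 0} \<times> {w\<in>W. L w = 0})" using cw by force
    qed (use sum L in auto)
  qed
  then show ?thesis using bij_betw_same_card by (fastforce simp: card_cartesian_product)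
qed

section \<open>Cyclic decomposition\<close>

context endomorphism
begin

text \<open>Each complement is taken inside the previous one. An entry 1 stands for a zero summand,
  since only the zero vector has order 1; this allows lists of prescribed length.\<close>

fun decomp :: "'a poly list \<Rightarrow> 'b set \<Rightarrow> bool" where
  "decomp [] S \<longleftrightarrow> S = {0}"
| "decomp (m # ms) S \<longleftrightarrow> (\<exists>v W. v \<in> S \<and> is_order m v \<and> stable W \<and> W \<subseteq> S \<and>
      cyclic v \<inter> W = {0} \<and> (\<forall>s\<in>S. \<exists>c\<in>cyclic v. \<exists>w\<in>W. s = c + w) \<and> decomp ms W)"

lemma act_cyclic_closed: "c \<in> cyclic v \<Longrightarrow> act f c \<in> cyclic v"
  by (auto elim!: cyclicE simp flip: act_mult)

text \<open>\<open>L\<close> is any additive map preserving both summands, so that one splitting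
  made for \<open>T\<close> also serves polynomials in \<open>U\<close>, and the zero map, whose
  kernels are the summands themselves.\<close>

lemma card_kernel_complement:
  assumes S: "stable S" and v: "v \<in> S" and W: "stable W" "W \<subseteq> S" and int: "cyclic v \<inter> W = {0}"
    and span: "\<forall>s\<in>S. \<exists>c\<in>cyclic v. \<exists>w\<in>W. s = c + w"
    and L: "\<And>x y. L (x + y) = L x + L y" "\<And>x. x \<in> cyclic v \<Longrightarrow> L x \<in> cyclic v" "\<And>x. x \<in> W \<Longrightarrow> L x \<in> W"
  shows "card {s\<in>S. L s = 0} = card {c\<in>cyclic v. L c = 0} * card {w\<in>W. L w = 0}"
proof (rule card_kernel_direct_sum)
  have sub: "subspace S" "subspace W" using S W by (auto simp: stable_def)
  show "x - y \<in> cyclic v" if "x \<in> cyclic v" "y \<in> cyclic v" for x y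
    using that by (rule subspace_diff[OF subspace_cyclic])
  show "x - y \<in> W" if "x \<in> W" "y \<in> W" for x y
    using that by (rule subspace_diff[OF sub(2)])
  show "s \<in> S \<longleftrightarrow> (\<exists>c\<in>cyclic v. \<exists>w\<in>W. s = c + w)" for s
  proof
    show "s \<in> S" if "\<exists>c\<in>cyclic v. \<exists>w\<in>W. s = c + w"
      using that cyclic_subset[OF S v] W(2) subspace_add[OF sub(1)] by blast
  qed (use span in blast)
qed (use L int in auto)

end

context inverse_pair
begin

text \<open>Kernel sizes are multiplicative over the splitting for both operators, and the cyclic
  factors agree. That common factor is positive because it counts 0, so it cancels.\<close>

lemma balanced_complement:
  assumes S: "inv_stable S" "balanced S" and v: "v \<in> S"
    and m: "T.is_order m v" "U.is_order m v"
    and W: "T.stable W" "W \<subseteq> S" and int: "T.cyclic v \<inter> W = {0}"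
    and span: "\<forall>s\<in>S. \<exists>c\<in>T.cyclic v. \<exists>w\<in>W. s = c + w"
  shows "balanced W"
  unfolding balanced_def
proof
  fix f
  have W': "inv_stable W" using inv_stable_subset[OF S(1) W] .
  have TS: "T.stable S" using S(1) by (simp add: inv_stable_def)
  have finC: "finite (T.cyclic v)" using T.cyclic_subset[OF TS v] TS
    by (auto simp: T.stable_def intro: finite_subset)
  have CW: "inv_stable (T.cyclic v)"
  proof (rule inv_stable_subset[OF S(1)])
    have "T c \<in> T.cyclic v" if "c \<in> T.cyclic v" for c
      using T.act_cyclic_closed[OF that, of "[:0, 1:]"] by simp
    then show "T.stable (T.cyclic v)" using finC T.subspace_cyclic by (auto simp: T.stable_def)
  qed (rule T.cyclic_subset[OF TS v])
  have kT: "card {s\<in>S. T.act f s = 0} = card {c\<in>T.cyclic v. T.act f c = 0} * card {w\<in>W. T.act f w = 0}"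
    by (rule T.card_kernel_complement[OF TS v W int span])
      (auto simp: T.act_vec_add T.act_cyclic_closed T.act_closed[OF W(1)])
  have kU: "card {s\<in>S. U.act f s = 0} = card {c\<in>T.cyclic v. U.act f c = 0} * card {w\<in>W. U.act f w = 0}"
  proof (rule T.card_kernel_complement[OF TS v W int span])
    show "U.act f x \<in> T.cyclic v" if "x \<in> T.cyclic v" for x
      using CW that by (auto simp: inv_stable_def intro: U.act_closed)
    show "U.act f x \<in> W" if "x \<in> W" for x
      using W' that by (auto simp: inv_stable_def intro: U.act_closed)
  qed (rule U.act_vec_add)
  have eq: "card {c\<in>T.cyclic v. T.act f c = 0} = card {c\<in>T.cyclic v. U.act f c = 0}"
    using balanced_cyclic[OF S(1) v m] by (simp add: balanced_def)
  have "0 \<in> {c\<in>T.cyclic v. T.act f c = 0}" using T.act_in_cyclic[of 0 v] by simp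
  then have "card {c\<in>T.cyclic v. T.act f c = 0} > 0" using finC by (auto simp: card_gt_0_iff)
  then show "card {w\<in>W. T.act f w = 0} = card {w\<in>W. U.act f w = 0}"
    using S(2) kT kU eq by (simp add: balanced_def)
qed

text \<open>The last conjunct strengthens the induction and yields the divisibility chain: the
  maximal order \<open>m\<close> of \<open>S\<close> kills \<open>W\<close>, hence is a multiple of
  all orders found there. The size bound ensures that \<open>N\<close> summands exhaust
  \<open>S\<close>; surplus entries are 1.\<close>

lemma ex_self_recip_decomp:
  assumes "finite (UNIV :: 'a set)"
    and "inv_stable S" "balanced S" and "card S \<le> CARD('a) ^ N"
  shows "\<exists>ms. length ms = N \<and> (\<forall>m\<in>set ms. self_recip m) \<and> sorted_wrt (\<lambda>a b. b dvd a) ms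
    \<and> card S = CARD('a) ^ (\<Sum>m\<leftarrow>ms. degree m) \<and> T.decomp ms S
    \<and> (\<forall>p. (\<forall>s\<in>S. T.act p s = 0) \<longrightarrow> (\<forall>m\<in>set ms. m dvd p))"
  using assms(2-)
proof (induction N arbitrary: S)
  case 0
  have "0 \<in> S" "finite S" using 0(1) by (auto simp: inv_stable_def T.stable_def subspace_0)
  then have "S = {0}" using 0(3) card_le_Suc0_iff_eq by fastforce
  then show ?case by (intro exI[of _ "[]"]) simp
next
  case (Suc N)
  note S = Suc.prems(1,2)
  have TS: "T.stable S" using S(1) by (simp add: inv_stable_def)
  obtain v m where v: "v \<in> S" and m: "T.is_order m v" and ann: "\<forall>s\<in>S. T.act m s = 0"
    using T.ex_maximal_order[OF TS] by blast
  obtain W where W: "T.stable W" "W \<subseteq> S" and int: "T.cyclic v \<inter> W = {0}"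
    and span: "\<forall>s\<in>S. \<exists>c\<in>T.cyclic v. \<exists>w\<in>W. s = c + w"
    using T.cyclic_complement[OF TS v m] ann by blast
  have sr: "self_recip m" and "U.act m v = 0"
    using self_recip_annihilator[OF S v m] ann v by auto
  then have mU: "U.is_order m v" using U_is_order[OF S(1) v m] by blast
  have W': "inv_stable W" "balanced W"
    using inv_stable_subset[OF S(1) W] balanced_complement[OF S v m mU W int span] .
  let ?q = "CARD('a)"
  have q: "?q \<ge> 2" using card_mono[OF assms(1), of "{0, 1}"] by simp
  have "card {s\<in>S. (0::'b) = 0} = card {c\<in>T.cyclic v. (0::'b) = 0} * card {w\<in>W. (0::'b) = 0}"
    by (rule T.card_kernel_complement[OF TS v W int span])
      (use int in auto)
  then have card: "card S = ?q ^ degree m * card W"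
    using bij_betw_same_card[OF T.bij_betw_act_cyclic[OF m]] by (simp add: card_polys_below)
  have "card W \<le> ?q ^ N"
  \<comment> \<open>Degree 0 means that the maximal order is 1 and \<open>S\<close> is zero;
    otherwise the summand uses up at least one factor q of the size bound.\<close>
  proof (cases "degree m = 0")
    case True
    have "m \<noteq> 0" using m by (auto simp: T.is_order_def)
    then have "m dvd 1" using True is_unit_iff_degree by blast
    then have "S \<subseteq> {0}" using T.act_dvd[of m 1] ann by auto
    then have "card W \<le> 1" using W(2) card_mono[of "{0}" W] by auto
    then show ?thesis using q by (meson le_trans one_le_power one_le_numeral)
  next
    case False
    have "?q * card W \<le> ?q ^ degree m * card W" using False q by (simp add: self_le_power)
    also have "\<dots> \<le> ?q * ?q ^ N" using Suc.prems(3) card by simp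
    finally show ?thesis using q by simp
  qed
  then obtain ms where ms: "length ms = N" "\<forall>m\<in>set ms. self_recip m" "sorted_wrt (\<lambda>a b. b dvd a) ms"
     "card W = ?q ^ (\<Sum>m\<leftarrow>ms. degree m)" "T.decomp ms W"
     "\<And>p. (\<forall>s\<in>W. T.act p s = 0) \<Longrightarrow> (\<forall>m\<in>set ms. m dvd p)"
    using Suc.IH[OF W'] by metis
  have "\<forall>m'\<in>set ms. m' dvd m" using ms(6)[of m] ann W(2) by blast
  moreover have "m dvd p" if "\<forall>s\<in>S. T.act p s = 0" for p
    using bspec[OF that v] m unfolding T.is_order_def by blast
  moreover have "\<forall>m\<in>set ms. m dvd p" if "\<forall>s\<in>S. T.act p s = 0" for p
    using ms(6)[of p] that W(2) by blast
  moreover have "T.decomp (m # ms) S" using v m W int span ms(5) by auto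
  ultimately show ?case using ms sr card
    by (intro exI[of _ "m # ms"]) (simp add: power_add)
qed

end

text \<open>Generators of equal order have the same annihilator, so sending \<open>act p v\<close>
  to the corresponding multiple of \<open>v'\<close> is well defined and bijective; the complements
  are matched by induction.\<close>

lemma decomp_isomorphic:
  assumes T: "endomorphism scale T" and T': "endomorphism scale' T'"
    and S: "endomorphism.stable scale T S" "endomorphism.decomp scale T ms S"
    and S': "endomorphism.stable scale' T' S'" "endomorphism.decomp scale' T' ms S'"
  shows "\<exists>h. bij_betw h S S' \<and> (\<forall>x\<in>S. \<forall>y\<in>S. h (x + y) = h x + h y)
    \<and> (\<forall>a. \<forall>x\<in>S. h (scale a x) = scale' a (h x)) \<and> (\<forall>x\<in>S. h (T x) = T' (h x))"
proof -
  interpret A: endomorphism scale T by (rule T)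
  interpret B: endomorphism scale' T' by (rule T')
  show ?thesis
    using S S'
  proof (induction ms arbitrary: S S')
    case Nil
    then show ?case by (intro exI[of _ "\<lambda>_. 0"]) (auto simp: bij_betw_def)
  next
    case (Cons m ms)
    obtain v W where v: "v \<in> S" "A.is_order m v" and W: "A.stable W" "W \<subseteq> S"
      and int: "A.cyclic v \<inter> W = {0}"
      and span: "\<And>s. s \<in> S \<Longrightarrow> \<exists>c\<in>A.cyclic v. \<exists>w\<in>W. s = c + w" and dW: "A.decomp ms W"
      using Cons.prems(2) by auto
    obtain v' W' where v': "v' \<in> S'" "B.is_order m v'" and W': "B.stable W'" "W' \<subseteq> S'"
      and int': "B.cyclic v' \<inter> W' = {0}"
      and span': "\<And>s. s \<in> S' \<Longrightarrow> \<exists>c\<in>B.cyclic v'. \<exists>w\<in>W'. s = c + w" and dW': "B.decomp ms W'"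
      using Cons.prems(4) by auto
    obtain f where f: "bij_betw f W W'"
      and f_add: "\<And>x y. x \<in> W \<Longrightarrow> y \<in> W \<Longrightarrow> f (x + y) = f x + f y"
      and f_scale: "\<And>a x. x \<in> W \<Longrightarrow> f (scale a x) = scale' a (f x)"
      and f_T: "\<And>x. x \<in> W \<Longrightarrow> f (T x) = T' (f x)"
      using Cons.IH[OF W(1) dW W'(1) dW'] by blast
    have fW: "f w \<in> W'" if "w \<in> W" for w using f that by (auto simp: bij_betw_def)
    have subW: "A.subspace W" "A.subspace S" and subW': "B.subspace W'" "B.subspace S'"
      using W(1) W'(1) Cons.prems by (simp_all add: A.stable_def B.stable_def)
    have uniq: "A.act (p - p') v = 0 \<and> w = w'"
      if "w \<in> W" "w' \<in> W" "A.act p v + w = A.act p' v + w'" for p p' w w'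
    proof -
      have e: "A.act (p - p') v = w' - w" using that(3) by (simp add: A.act_diff algebra_simps)
      then have "A.act (p - p') v \<in> A.cyclic v \<inter> W"
        using that(1,2) A.subspace_diff[OF subW(1)] by (metis A.act_in_cyclic IntI)
      then show ?thesis using int e by simp
    qed
    have uniq': "B.act (p - p') v' = 0 \<and> w = w'"
      if "w \<in> W'" "w' \<in> W'" "B.act p v' + w = B.act p' v' + w'" for p p' w w'
    proof -
      have e: "B.act (p - p') v' = w' - w" using that(3) by (simp add: B.act_diff algebra_simps)
      then have "B.act (p - p') v' \<in> B.cyclic v' \<inter> W'"
        using that(1,2) B.subspace_diff[OF subW'(1)] by (metis B.act_in_cyclic IntI)
      then show ?thesis using int' e by simp
    qed
    have act_eq: "A.act p v = 0 \<longleftrightarrow> B.act p v' = 0" for p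
      using v(2) v'(2) by (simp add: A.is_order_def B.is_order_def)
    \<comment> \<open>The polynomial \<open>p\<close> is determined only modulo the order
      \<open>m\<close>; the choice has no effect on the value, as both generators have the same
      annihilator.\<close>
    define h where "h s = (SOME y. \<exists>p. \<exists>w\<in>W. s = A.act p v + w \<and> y = B.act p v' + f w)" for s
    have h: "h (A.act p v + w) = B.act p v' + f w" if w: "w \<in> W" for p w
    proof -
      have "\<exists>p'. \<exists>w'\<in>W. A.act p v + w = A.act p' v + w' \<and> h (A.act p v + w) = B.act p' v' + f w'"
        unfolding h_def by (rule someI_ex) (use w in blast)
      then obtain p' w' where *: "w' \<in> W" "A.act p v + w = A.act p' v + w'"
        "h (A.act p v + w) = B.act p' v' + f w'" by blast
      then have "A.act (p - p') v = 0" "w = w'" using uniq[OF w *(1,2)] by auto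
      then show ?thesis using *(3) act_eq[of "p - p'"] by (simp add: B.act_diff)
    qed
    have dec: "\<exists>p. \<exists>w\<in>W. s = A.act p v + w" if "s \<in> S" for s
      using span[OF that] by (metis A.cyclicE)
    have dec': "\<exists>p. \<exists>w\<in>W. s = B.act p v' + f w" if "s \<in> S'" for s
      using span'[OF that] f by (metis B.cyclicE bij_betw_imp_surj_on imageE)
    have "inj_on h S"
    proof (rule inj_onI)
      fix x y assume xy: "x \<in> S" "y \<in> S" "h x = h y"
      obtain p w where p: "w \<in> W" "x = A.act p v + w" using dec[OF xy(1)] by blast
      obtain p' w' where p': "w' \<in> W" "y = A.act p' v + w'" using dec[OF xy(2)] by blast
      have "B.act (p - p') v' = 0 \<and> f w = f w'"
        using xy(3) p p' h fW by (intro uniq') auto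
      then have "A.act (p - p') v = 0" "w = w'"
        using act_eq f p(1) p'(1) by (auto simp: bij_betw_def inj_on_def)
      then show "x = y" using p p' by (simp add: A.act_diff)
    qed
    moreover have "h ` S = S'"
    proof (intro equalityI subsetI)
      fix y assume "y \<in> h ` S"
      then obtain p w where "w \<in> W" "y = B.act p v' + f w" using dec h by blast
      then show "y \<in> S'" using B.act_closed[OF Cons.prems(3) v'(1)] fW W'(2) B.subspace_add[OF subW'(2)] by blast
    next
      fix y assume "y \<in> S'"
      then obtain p w where pw: "w \<in> W" "y = B.act p v' + f w" using dec' by blast
      then have "A.act p v + w \<in> S"
        using A.act_closed[OF Cons.prems(1) v(1)] W(2) A.subspace_add[OF subW(2)] by blast
      then show "y \<in> h ` S" using pw h by (metis image_eqI)
    qed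
    moreover have "h (x + y) = h x + h y" if xy: "x \<in> S" "y \<in> S" for x y
    proof -
      obtain p w where p: "w \<in> W" "x = A.act p v + w" using dec[OF xy(1)] by blast
      obtain p' w' where p': "w' \<in> W" "y = A.act p' v + w'" using dec[OF xy(2)] by blast
      have "x + y = A.act (p + p') v + (w + w')" using p p' by (simp add: A.act_add)
      moreover have "w + w' \<in> W" using p p' A.subspace_add[OF subW(1)] by blast
      ultimately have "h (x + y) = B.act (p + p') v' + f (w + w')" using h by metis
      then show ?thesis using p p' h by (simp add: B.act_add f_add)
    qed
    moreover have "h (scale a x) = scale' a (h x)" if x: "x \<in> S" for a x
    proof -
      obtain p w where p: "w \<in> W" "x = A.act p v + w" using dec[OF x] by blast
      have "scale a x = A.act (smult a p) v + scale a w" using p by (simp add: A.act_smult A.scale_right_distrib)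
      moreover have "scale a w \<in> W" using p A.subspace_scale[OF subW(1)] by blast
      ultimately have "h (scale a x) = B.act (smult a p) v' + f (scale a w)" using h by metis
      then show ?thesis using p h by (simp add: B.act_smult B.scale_right_distrib f_scale)
    qed
    moreover have "h (T x) = T' (h x)" if x: "x \<in> S" for x
    proof -
      obtain p w where p: "w \<in> W" "x = A.act p v + w" using dec[OF x] by blast
      have "T x = A.act (pCons 0 p) v + T w" using p by (simp add: A.T_add)
      moreover have "T w \<in> W" using p W(1) by (auto simp: A.stable_def)
      ultimately have "h (T x) = B.act (pCons 0 p) v' + f (T w)" using h by metis
      then show ?thesis using p h by (simp add: f_T B.T_add)
    qed
    ultimately show ?case by (intro exI[of _ h]) (auto simp: bij_betw_def)
  qed
qed

section \<open>Twisted conjugacy classes and Burnside's lemma\<close>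

text \<open>The maps are restricted to \<open>E\<close> because elements of
  \<open>BijGroup E\<close> are undefined outside \<open>E\<close>.\<close>

lemma (in group) group_actionI:
  assumes closed: "\<And>g x. g \<in> carrier G \<Longrightarrow> x \<in> E \<Longrightarrow> \<phi> g x \<in> E"
    and one: "\<And>x. x \<in> E \<Longrightarrow> \<phi> \<one> x = x"
    and mult: "\<And>g h x. g \<in> carrier G \<Longrightarrow> h \<in> carrier G \<Longrightarrow> x \<in> E \<Longrightarrow> \<phi> (g \<otimes> h) x = \<phi> g (\<phi> h x)"
  shows "group_action G E (\<lambda>g. restrict (\<phi> g) E)"
proof -
  have Bij: "restrict (\<phi> g) E \<in> Bij E" if g: "g \<in> carrier G" for g
  proof -
    have 1: "\<phi> (inv g) (\<phi> g x) = x" and 2: "\<phi> g (\<phi> (inv g) x) = x" if "x \<in> E" for x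
      using g that mult[of "inv g" g x] mult[of g "inv g" x] one by simp_all
    have "bij_betw (\<phi> g) E E"
      by (rule bij_betw_byWitness[where f' = "\<phi> (inv g)"]) (use g 1 2 closed in auto)
    then have "bij_betw (restrict (\<phi> g) E) E E" by (rule bij_betw_cong[THEN iffD1, rotated]) simp
    then show ?thesis by (simp add: Bij_def)
  qed
  have "(\<lambda>g. restrict (\<phi> g) E) \<in> hom G (BijGroup E)"
  proof (rule homI)
    show "restrict (\<phi> g) E \<in> carrier (BijGroup E)" if "g \<in> carrier G" for g
      using Bij[OF that] by (simp add: BijGroup_def)
    show "restrict (\<phi> (g \<otimes> h)) E = restrict (\<phi> g) E \<otimes>\<^bsub>BijGroup E\<^esub> restrict (\<phi> h) E"
      if "g \<in> carrier G" "h \<in> carrier G" for g h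
      using that Bij closed mult by (auto simp: BijGroup_def compose_def fun_eq_iff)
  qed
  then show ?thesis
    by (simp add: group_action_def group_hom_def group_hom_axioms_def group_BijGroup is_group)
qed

lemma orbit_restrict:
  "x \<in> E \<Longrightarrow> orbit G (\<lambda>g. restrict (\<phi> g) E) x = orbit G \<phi> x"
  by (simp add: orbit_def)

lemma orbits_restrict: "orbits G E (\<lambda>g. restrict (\<phi> g) E) = orbits G E \<phi>"
  unfolding orbits_def using orbit_restrict[of _ E G \<phi>] by metis

text \<open>Both sides count, up to the factor \<open>|G|\<close>, the pairs \<open>(g, x)\<close> with \<open>g x \<sigma>(g)\<^sup>-\<^sup>1 = x\<close>,
  since for a given \<open>g\<close> the solutions \<open>x\<close> form a coset of the centralizer of \<open>g\<close> or do not exist.\<close>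

lemma (in group) card_twisted_classes:
  assumes fin: "finite (carrier G)" and \<sigma>: "\<sigma> \<in> hom G G"
  defines "E \<equiv> {g \<in> carrier G. \<exists>x\<in>carrier G. g \<otimes> x \<otimes> inv (\<sigma> g) = x}"
  shows "card (orbits G (carrier G) (\<lambda>g x. g \<otimes> x \<otimes> inv (\<sigma> g)))
    = card (orbits G E (\<lambda>g x. g \<otimes> x \<otimes> inv g))"
proof -
  interpret h: group_hom G G \<sigma> by unfold_locales (rule \<sigma>)
  have cancel: "inv a \<otimes> (a \<otimes> b) = b" "a \<otimes> (inv a \<otimes> b) = b" if "a \<in> carrier G" "b \<in> carrier G" for a b
    using that by (simp_all flip: m_assoc)
  let ?t = "\<lambda>g x. g \<otimes> x \<otimes> inv (\<sigma> g)" and ?c = "\<lambda>g x. g \<otimes> x \<otimes> inv g"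
  have E: "E \<subseteq> carrier G" by (auto simp: E_def)
  interpret t: group_action G "carrier G" "\<lambda>g. restrict (?t g) (carrier G)"
    by (rule group_actionI) (simp_all add: inv_mult_group m_assoc)
  interpret c: group_action G E "\<lambda>g. restrict (?c g) E"
  proof (rule group_actionI)
    fix g x assume g: "g \<in> carrier G" and x: "x \<in> E"
    then obtain y where y: "y \<in> carrier G" "x \<otimes> y \<otimes> inv (\<sigma> x) = y" "x \<in> carrier G"
      by (auto simp: E_def)
    have "?c g x \<otimes> (g \<otimes> y \<otimes> inv (\<sigma> g)) \<otimes> inv (\<sigma> (?c g x)) = g \<otimes> (x \<otimes> y \<otimes> inv (\<sigma> x)) \<otimes> inv (\<sigma> g)"
      using g y(1,3) by (simp add: m_assoc inv_mult_group cancel)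
    also have "\<dots> = g \<otimes> y \<otimes> inv (\<sigma> g)" by (simp add: y(2))
    finally show "?c g x \<in> E" unfolding E_def using g y(1,3) by auto
  qed (use E in \<open>auto simp: inv_mult_group m_assoc subset_iff\<close>)
  have finE: "finite E" using E fin by (rule finite_subset)
  have fix_t: "card {x\<in>carrier G. ?t g x = x} = (if g \<in> E then card {h\<in>carrier G. ?c h g = g} else 0)"
    if g: "g \<in> carrier G" for g
  proof (cases "g \<in> E")
    case True
    then obtain x where x: "x \<in> carrier G" "g \<otimes> x \<otimes> inv (\<sigma> g) = x" by (auto simp: E_def)
    have gx: "g \<otimes> x = x \<otimes> \<sigma> g" using x g by (metis inv_solve_right' m_closed h.hom_closed)
    have \<sigma>g: "\<sigma> g = inv x \<otimes> g \<otimes> x" using gx x(1) g by (simp add: m_assoc cancel)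
    \<comment> \<open>A solution \<open>x\<close> means that \<open>g\<close> followed by
      \<open>x\<close> equals \<open>x\<close> followed by \<open>\<sigma> g\<close>; with this,
      \<open>h \<otimes> x\<close> is a solution exactly if \<open>h\<close> commutes with
      \<open>g\<close>.\<close>
    have "bij_betw (\<lambda>h. h \<otimes> x) {h\<in>carrier G. ?c h g = g} {y\<in>carrier G. ?t g y = y}"
    proof (rule bij_betw_byWitness[where f' = "\<lambda>y. y \<otimes> inv x"])
      have "g \<otimes> (h \<otimes> x) \<otimes> inv (\<sigma> g) = h \<otimes> x \<longleftrightarrow> h \<otimes> g \<otimes> inv h = g" if h: "h \<in> carrier G" for h
      proof -
        have "g \<otimes> (h \<otimes> x) \<otimes> inv (\<sigma> g) = h \<otimes> x \<longleftrightarrow> g \<otimes> (h \<otimes> x) = h \<otimes> x \<otimes> \<sigma> g"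
          using g h x(1) by (metis h.hom_closed inv_solve_right' m_closed)
        also have "h \<otimes> x \<otimes> \<sigma> g = h \<otimes> g \<otimes> x" using gx g h x(1) by (simp add: m_assoc)
        also have "g \<otimes> (h \<otimes> x) = h \<otimes> g \<otimes> x \<longleftrightarrow> g \<otimes> h = h \<otimes> g"
          using g h x(1) by (simp flip: m_assoc)
        also have "\<dots> \<longleftrightarrow> h \<otimes> g \<otimes> inv h = g"
          using g h by (metis inv_solve_right' m_closed)
        finally show ?thesis .
      qed
      then show "(\<lambda>h. h \<otimes> x) ` {h\<in>carrier G. ?c h g = g} \<subseteq> {y\<in>carrier G. ?t g y = y}"
        and "(\<lambda>y. y \<otimes> inv x) ` {y\<in>carrier G. ?t g y = y} \<subseteq> {h\<in>carrier G. ?c h g = g}"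
        using x(1) by (auto simp: m_assoc) (metis inv_closed l_inv m_assoc m_closed r_one)
    qed (use x(1) in \<open>simp_all add: m_assoc\<close>)
    then show ?thesis using True by (simp add: bij_betw_same_card)
  next
    case False
    then have "{x\<in>carrier G. ?t g x = x} = {}" using g by (auto simp: E_def)
    then show ?thesis using False by (metis card.empty)
  qed
  have "card (orbits G (carrier G) ?t) * Coset.order G
      = (\<Sum>g\<in>carrier G. card {x\<in>carrier G. ?t g x = x})"
    using t.burnside[OF fin fin] by (simp add: orbits_restrict invariants_def cong: conj_cong)
  also have "\<dots> = (\<Sum>g\<in>E. card {h\<in>carrier G. ?c h g = g})"
    using E fin by (simp add: fix_t sum.inter_restrict[symmetric] Int_absorb1 cong: sum.cong)
  also have "\<dots> = (\<Sum>g\<in>E. \<Sum>h\<in>carrier G. if ?c h g = g then 1 else 0)"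
    using fin by (simp add: card_as_sums)
  also have "\<dots> = (\<Sum>h\<in>carrier G. \<Sum>g\<in>E. if ?c h g = g then 1 else 0)"
    by (rule sum.swap)
  also have "\<dots> = (\<Sum>h\<in>carrier G. card {g\<in>E. ?c h g = g})"
    using finE by (simp add: card_as_sums)
  also have "\<dots> = card (orbits G E ?c) * Coset.order G"
    using c.burnside[OF fin finE] by (simp add: orbits_restrict invariants_def cong: conj_cong)
  finally show ?thesis using fin by (simp add: order_gt_0_iff_finite[symmetric])
qed

section \<open>Adjoint operators\<close>

context vector_space
begin

text \<open>Rescaling \<open>s\<close> to value 1 splits \<open>S\<close> into the kernel and a line
  with as many points as the field.\<close>

lemma card_kernel_functional:
  assumes S: "subspace S" and l: "\<And>x y. l (x + y) = l x + l y" "\<And>a x. l (scale a x) = a * l x"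
    and s: "s \<in> S" "l s \<noteq> 0"
  shows "card {v\<in>S. l v = 0} * CARD('a) = card S"
proof -
  define s0 where "s0 = scale (inverse (l s)) s"
  have s0: "s0 \<in> S" "l s0 = 1" using s by (simp_all add: s0_def l subspace_scale[OF S])
  have "bij_betw (\<lambda>(v, a). v + scale a s0) ({v\<in>S. l v = 0} \<times> UNIV) S"
  proof (rule bij_betwI[where g = "\<lambda>x. (x - scale (l x) s0, l x)"])
    have diff: "l (x - scale (l x) s0) = 0" for x
      using l(1)[of "x - scale (l x) s0" "scale (l x) s0"] s0(2) by (simp add: l(2))
    show "(\<lambda>x. (x - scale (l x) s0, l x)) \<in> S \<rightarrow> {v\<in>S. l v = 0} \<times> UNIV"
      using diff by (auto intro: subspace_diff[OF S] subspace_scale[OF S] s0)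
  qed (use s0 in \<open>auto simp: l intro: subspace_add[OF S] subspace_scale[OF S]\<close>)
  then show ?thesis using bij_betw_same_card by (fastforce simp: card_cartesian_product)
qed

text \<open>Both kernels are read off from the number of pairs \<open>(u, v)\<close> with \<open>\<beta> (L u) v = 0\<close>.\<close>

lemma card_kernel_adjoint:
  fixes \<beta> :: "'b \<Rightarrow> 'b \<Rightarrow> 'a"
  assumes field: "finite (UNIV :: 'a set)" and S: "subspace S" "finite S"
    and left: "\<And>x y v. \<beta> (x + y) v = \<beta> x v + \<beta> y v" "\<And>a x v. \<beta> (scale a x) v = a * \<beta> x v"
    and right: "\<And>x u v. \<beta> x (u + v) = \<beta> x u + \<beta> x v" "\<And>a x v. \<beta> x (scale a v) = a * \<beta> x v"
    and nondeg: "\<And>u. u \<in> S \<Longrightarrow> (\<And>v. v \<in> S \<Longrightarrow> \<beta> u v = 0) \<Longrightarrow> u = 0"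
      "\<And>v. v \<in> S \<Longrightarrow> (\<And>u. u \<in> S \<Longrightarrow> \<beta> u v = 0) \<Longrightarrow> v = 0"
    and LS: "\<And>u. u \<in> S \<Longrightarrow> L u \<in> S" "\<And>v. v \<in> S \<Longrightarrow> L' v \<in> S"
    and adj: "\<And>u v. u \<in> S \<Longrightarrow> v \<in> S \<Longrightarrow> \<beta> (L u) v = \<beta> u (L' v)"
  shows "card {u\<in>S. L u = 0} = card {v\<in>S. L' v = 0}"
proof -
  let ?q = "CARD('a)"
  define k where "k = card {u\<in>S. L u = 0}"
  define k' where "k' = card {v\<in>S. L' v = 0}"
  have \<beta>0: "\<beta> 0 v = 0" "\<beta> v 0 = 0" for v using left(2)[of 0 0 v] right(2)[of v 0 0] by simp_all
  \<comment> \<open>The functional belonging to \<open>u\<close> is zero exactly if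
    \<open>L u = 0\<close>, and otherwise its kernel has index q. Counts are multiplied by q to
    avoid a division.\<close>
  have 1: "card {v\<in>S. \<beta> (L u) v = 0} * ?q = (if L u = 0 then card S * ?q else card S)" if u: "u \<in> S" for u
  proof (cases "L u = 0")
    case False
    then obtain s where "s \<in> S" "\<beta> (L u) s \<noteq> 0" using nondeg(1)[OF LS(1)[OF u]] by blast
    then show ?thesis using False card_kernel_functional[OF S(1), of "\<beta> (L u)"] right by simp
  qed (simp add: \<beta>0)
  have 2: "card {u\<in>S. \<beta> u (L' v) = 0} * ?q = (if L' v = 0 then card S * ?q else card S)" if v: "v \<in> S" for v
  proof (cases "L' v = 0")
    case False
    then obtain s where "s \<in> S" "\<beta> s (L' v) \<noteq> 0" using nondeg(2)[OF LS(2)[OF v]] by blast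
    then show ?thesis using False card_kernel_functional[OF S(1), of "\<lambda>u. \<beta> u (L' v)"] left by simp
  qed (simp add: \<beta>0)
  have split: "(\<Sum>u\<in>S. if M u = 0 then card S * ?q else card S)
      = card S * (card {u\<in>S. M u = 0} * ?q + (card S - card {u\<in>S. M u = 0}))" for M :: "'b \<Rightarrow> 'b"
  proof -
    have "S \<inter> {u. M u = 0} = {u\<in>S. M u = 0}" "S \<inter> - {u. M u = 0} = S - {u\<in>S. M u = 0}" by blast+
    then show ?thesis using S(2) by (simp add: sum.If_cases card_Diff_subset algebra_simps)
  qed
  have "(\<Sum>u\<in>S. card {v\<in>S. \<beta> (L u) v = 0}) = (\<Sum>u\<in>S. \<Sum>v\<in>S. if \<beta> (L u) v = 0 then 1 else 0 :: nat)"
    using S(2) by (intro sum.cong refl card_as_sums)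
  also have "\<dots> = (\<Sum>v\<in>S. \<Sum>u\<in>S. if \<beta> u (L' v) = 0 then 1 else 0 :: nat)"
    by (subst sum.swap) (intro sum.cong refl, simp add: adj)
  also have "\<dots> = (\<Sum>v\<in>S. card {u\<in>S. \<beta> u (L' v) = 0})"
    using S(2) by (intro sum.cong refl card_as_sums[symmetric])
  finally have "(\<Sum>u\<in>S. card {v\<in>S. \<beta> (L u) v = 0} * ?q) = (\<Sum>v\<in>S. card {u\<in>S. \<beta> u (L' v) = 0} * ?q)"
    by (simp flip: sum_distrib_right)
  then have "card S * (k * ?q + (card S - k)) = card S * (k' * ?q + (card S - k'))"
    using split[of L] split[of L'] by (simp add: 1 2 k_def k'_def cong: sum.cong_simp)
  moreover have "card S > 0" using S subspace_0 by (auto simp: card_gt_0_iff)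
  ultimately have "k * ?q + (card S - k) = k' * ?q + (card S - k')" by simp
  moreover have "k \<le> card S" "k' \<le> card S" using S(2) by (simp_all add: k_def k'_def card_mono)
  \<comment> \<open>Over the integers the common term \<open>card S\<close> cancels and the factor q
    - 1, which is positive, remains.\<close>
  ultimately have "int k * (int ?q - 1) = int k' * (int ?q - 1)"
    by (simp add: algebra_simps of_nat_diff flip: of_nat_mult of_nat_add)
  moreover have "?q \<ge> 2" using card_mono[OF field, of "{0, 1}"] by simp
  ultimately show ?thesis by (simp add: k_def k'_def)
qed

end

section \<open>Matrices acting on coefficient vectors\<close>

text \<open>Coefficients serve as coordinates: vectors of every length thereby lie in one additive
  group, and the operator theory above applies with \<open>polys_below n\<close> as the finite
  subspace.\<close>

definition mact :: "'a::field mat \<Rightarrow> 'a poly \<Rightarrow> 'a poly" where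
  "mact A p = (\<Sum>i<dim_row A. monom (\<Sum>j<dim_col A. A $$ (i, j) * coeff p j) i)"

lemma coeff_mact:
  "coeff (mact A p) i = (if i < dim_row A then \<Sum>j<dim_col A. A $$ (i, j) * coeff p j else 0)"
  by (simp add: mact_def coeff_sum)

lemma endomorphism_mact: "endomorphism smult (mact A)"
proof -
  interpret vector_space "smult :: 'a \<Rightarrow> 'a poly \<Rightarrow> 'a poly" by (rule vector_space_poly)
  show ?thesis
    by unfold_locales
      (auto simp: poly_eq_iff coeff_mact sum.distrib sum_distrib_left algebra_simps)
qed

lemma mact_in_polys_below: "A \<in> carrier_mat n m \<Longrightarrow> mact A p \<in> polys_below n"
  by (auto simp: polys_below_def coeff_mact)

lemma mact_mult:
  assumes "A \<in> carrier_mat n n" "B \<in> carrier_mat n n"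
  shows "mact (A * B) p = mact A (mact B p)"
proof (rule poly_eqI)
  fix i
  have "(\<Sum>j<n. (\<Sum>k<n. A $$ (i, k) * B $$ (k, j)) * coeff p j)
      = (\<Sum>k<n. A $$ (i, k) * (\<Sum>j<n. B $$ (k, j) * coeff p j))"
    by (simp add: sum_distrib_left sum_distrib_right mult.assoc) (rule sum.swap)
  then show "coeff (mact (A * B) p) i = coeff (mact A (mact B p)) i"
    using assms by (auto simp: coeff_mact scalar_prod_def atLeast0LessThan cong: sum.cong_simp)
qed

lemma mact_one: "p \<in> polys_below n \<Longrightarrow> mact (1\<^sub>m n) p = p"
  by (auto simp: poly_eq_iff coeff_mact polys_below_def if_distrib[of "\<lambda>x. x * _"] cong: if_cong)

lemma mact_inject:
  assumes A: "A \<in> carrier_mat n n" "B \<in> carrier_mat n n"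
    and eq: "\<And>p. p \<in> polys_below n \<Longrightarrow> mact A p = mact B p"
  shows "A = B"
proof (rule eq_matI)
  fix i j assume ij: "i < dim_row B" "j < dim_col B"
  then have "monom (1::'a) j \<in> polys_below n" using A by (auto simp: polys_below_def)
  then have "coeff (mact A (monom 1 j)) i = coeff (mact B (monom 1 j)) i" using eq by simp
  then show "A $$ (i, j) = B $$ (i, j)"
    using A ij by (simp add: coeff_mact if_distrib[of "\<lambda>x. _ * x"] cong: if_cong)
qed (use A in auto)

text \<open>The columns of the matrix are the images of the monomials. Linearity is required on
  \<open>polys_below n\<close> only, as module isomorphisms are controlled only there.\<close>

lemma ex_mact:
  fixes h :: "'a::field poly \<Rightarrow> 'a poly"
  assumes h: "\<And>p. p \<in> polys_below n \<Longrightarrow> h p \<in> polys_below n"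
    and add: "\<And>p q. p \<in> polys_below n \<Longrightarrow> q \<in> polys_below n \<Longrightarrow> h (p + q) = h p + h q"
    and scale: "\<And>a p. p \<in> polys_below n \<Longrightarrow> h (smult a p) = smult a (h p)"
  shows "\<exists>P \<in> carrier_mat n n. \<forall>p\<in>polys_below n. mact P p = h p"
proof -
  define P where "P = mat n n (\<lambda>(i, j). coeff (h (monom 1 j)) i)"
  have P: "P \<in> carrier_mat n n" by (simp add: P_def)
  have h0: "h 0 = 0" using scale[of 0 0] by (simp add: polys_below_def)
  have hsum: "h (\<Sum>j\<in>A. monom (c j) j) = (\<Sum>j\<in>A. smult (c j) (h (monom 1 j)))"
    if "finite A" "A \<subseteq> {..<n}" for c A
    using that
  proof (induction A rule: finite_induct)
    case (insert j A)
    have m: "monom a j \<in> polys_below n" for a using insert.prems by (auto simp: polys_below_def)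
    have "(\<Sum>j\<in>A. monom (c j) j) \<in> polys_below n"
      using insert.prems insert.hyps(1) by (auto simp: polys_below_def coeff_sum intro!: sum.neutral)
    then have "h (monom (c j) j + (\<Sum>j\<in>A. monom (c j) j)) = h (monom (c j) j) + h (\<Sum>j\<in>A. monom (c j) j)"
      by (rule add[OF m])
    moreover have "h (monom (c j) j) = smult (c j) (h (monom 1 j))"
      using scale[OF m, of "c j" 1] by (simp add: smult_monom)
    ultimately show ?case using insert by simp
  qed (simp add: h0)
  have "mact P p = h p" if p: "p \<in> polys_below n" for p
  proof -
    have "p = (\<Sum>j<n. monom (coeff p j) j)"
      using p by (auto simp: poly_eq_iff coeff_sum polys_below_def)
    then have "h p = (\<Sum>j<n. smult (coeff p j) (h (monom 1 j)))" using hsum[of "{..<n}" "coeff p"] by simp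
    moreover have "h (monom 1 j) \<in> polys_below n" if "j < n" for j
      using that by (intro h) (auto simp: polys_below_def)
    ultimately show ?thesis
      by (auto simp: poly_eq_iff coeff_mact P_def coeff_sum mult.commute polys_below_def intro!: sum.neutral[symmetric])
  qed
  then show ?thesis using P by blast
qed

section \<open>The standard bilinear form and transposition\<close>

definition dot :: "nat \<Rightarrow> 'a::field poly \<Rightarrow> 'a poly \<Rightarrow> 'a" where
  "dot n u v = (\<Sum>i<n. coeff u i * coeff v i)"

lemma dot_linear:
  "dot n (x + y) v = dot n x v + dot n y v" "dot n (smult a x) v = a * dot n x v"
  "dot n v (x + y) = dot n v x + dot n v y" "dot n v (smult a x) = a * dot n v x"
  by (simp_all add: dot_def sum.distrib sum_distrib_left algebra_simps)

lemma dot_commute: "dot n u v = dot n v u"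
  by (simp add: dot_def mult.commute)

lemma dot_nondegenerate:
  assumes u: "u \<in> polys_below n" and z: "\<And>v. v \<in> polys_below n \<Longrightarrow> dot n u v = 0"
  shows "u = 0"
proof (rule poly_eqI)
  fix i show "coeff u i = coeff 0 i"
  proof (cases "i < n")
    case True
    then have "dot n u (monom 1 i) = 0" by (intro z) (auto simp: polys_below_def)
    then show ?thesis using True by (simp add: dot_def if_distrib[of "\<lambda>x. _ * x"] cong: if_cong)
  qed (use u in \<open>auto simp: polys_below_def\<close>)
qed

lemma dot_mact:
  assumes "A \<in> carrier_mat n n"
  shows "dot n (mact A u) v = dot n u (mact (transpose_mat A) v)"
proof -
  have "dot n (mact A u) v = (\<Sum>i<n. \<Sum>j<n. A $$ (i, j) * coeff u j * coeff v i)"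
    using assms by (simp add: dot_def coeff_mact sum_distrib_right)
  also have "\<dots> = (\<Sum>j<n. \<Sum>i<n. A $$ (i, j) * coeff u j * coeff v i)" by (rule sum.swap)
  also have "\<dots> = dot n u (mact (transpose_mat A) v)"
    using assms by (simp add: dot_def coeff_mact sum_distrib_left mult_ac cong: sum.cong_simp)
  finally show ?thesis .
qed

section \<open>Similarity of matrices with the same cyclic decomposition\<close>

lemma GL_inverse:
  assumes "g \<in> carrier (GL TYPE('a::field) n)"
  shows "inv\<^bsub>GL TYPE('a) n\<^esub> g \<in> carrier_mat n n"
    and "inv\<^bsub>GL TYPE('a) n\<^esub> g * g = 1\<^sub>m n" and "g * inv\<^bsub>GL TYPE('a) n\<^esub> g = 1\<^sub>m n"
proof -
  interpret group "GL TYPE('a) n" by (rule group_GL)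
  show "inv\<^bsub>GL TYPE('a) n\<^esub> g \<in> carrier_mat n n"
    using inv_closed[OF assms] by (simp add: carrier_GL_iff)
  show "inv\<^bsub>GL TYPE('a) n\<^esub> g * g = 1\<^sub>m n" "g * inv\<^bsub>GL TYPE('a) n\<^esub> g = 1\<^sub>m n"
    using l_inv[OF assms] r_inv[OF assms] by (simp_all add: mult_GL one_GL)
qed

lemma stable_mact:
  "g \<in> carrier_mat n n \<Longrightarrow> endomorphism.stable smult (mact g) (polys_below n :: 'a::{field,finite} poly set)"
  by (auto simp: endomorphism.stable_def[OF endomorphism_mact] subspace_polys_below finite_polys_below
      mact_in_polys_below)

lemma inverse_pair_mact: "inverse_pair smult (mact g) (mact h)"
  by (simp add: inverse_pair_def vector_space_poly endomorphism_mact)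

text \<open>Invariance of the form with matrix \<open>Y\<close> makes the inverse of
  \<open>g\<close> its adjoint, and by linearity f(g) is adjoint to f of the inverse. Adjoint
  operators have kernels of equal size, which is the balance condition.\<close>

lemma ex_self_recip_decomp_isometry:
  fixes g Y :: "'a::{field,finite} mat"
  assumes g: "g \<in> carrier (GL TYPE('a) n)" and Y: "Y \<in> carrier (GL TYPE('a) n)"
    and isometry: "transpose_mat g * Y * g = Y"
  shows "\<exists>ms. length ms = n \<and> (\<forall>m\<in>set ms. self_recip m) \<and> sorted_wrt (\<lambda>a b. b dvd a) ms
    \<and> (\<Sum>m\<leftarrow>ms. degree m) = n \<and> endomorphism.decomp smult (mact g) ms (polys_below n)"
proof -
  define S where "S = (polys_below n :: 'a poly set)"
  define h where "h = inv\<^bsub>GL TYPE('a) n\<^esub> g"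
  define Z where "Z = inv\<^bsub>GL TYPE('a) n\<^esub> Y"
  note hg = GL_inverse[OF g, folded h_def] and ZY = GL_inverse[OF Y, folded Z_def]
  have c: "g \<in> carrier_mat n n" "Y \<in> carrier_mat n n" using g Y by (auto simp: carrier_GL_iff)
  interpret pair: inverse_pair smult "mact g" "mact h" by (rule inverse_pair_mact)
  have gh: "mact h (mact g s) = s" "mact g (mact h s) = s" if "s \<in> S" for s
    using that c hg mact_mult[of h n g] mact_mult[of g n h] mact_one[of s n] by (simp_all add: S_def)
  have inv: "pair.inv_stable S"
    unfolding pair.inv_stable_def S_def
    using stable_mact[OF c(1)] stable_mact[OF hg(1)] gh by (simp add: S_def)
  define \<beta> where "\<beta> u v = dot n u (mact Y v)" for u v
  have \<beta>_g: "\<beta> (mact g u) (mact g v) = \<beta> u v" for u v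
  proof -
    have "\<beta> (mact g u) (mact g v) = dot n u (mact (transpose_mat g) (mact Y (mact g v)))"
      by (simp add: \<beta>_def dot_mact[OF c(1)])
    also have "mact (transpose_mat g) (mact Y (mact g v)) = mact (transpose_mat g * Y * g) v"
      using c by (simp add: mact_mult[of _ n])
    finally show ?thesis by (simp add: \<beta>_def isometry)
  qed
  interpret Y: endomorphism smult "mact Y" by (rule endomorphism_mact)
  have bal: "pair.balanced S"
    unfolding pair.balanced_def
  proof
    fix f
    \<comment> \<open>Invariance is applied to \<open>x\<close> and the preimage
      \<open>mact h y\<close> of \<open>y\<close>.\<close>
    have swap: "\<beta> (mact g x) y = \<beta> x (mact h y)" if "y \<in> S" for x y
      using \<beta>_g[of x "mact h y"] gh(2)[OF that] by simp
    have adj: "\<beta> (pair.T.act f u) v = \<beta> u (pair.U.act f v)" if "v \<in> S" for u v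
      using that
    proof (induction f arbitrary: v)
      case 0
      show ?case by (simp add: \<beta>_def dot_def)
    next
      case (pCons a f)
      have "mact h v \<in> S" using hg(1) by (simp add: S_def mact_in_polys_below)
      then have "\<beta> (mact g (pair.T.act f u)) v = \<beta> u (pair.U.act f (mact h v))"
        using swap[OF pCons.prems] pCons.IH by simp
      also have "pair.U.act f (mact h v) = mact h (pair.U.act f v)"
        using pair.U.act_commute[of f "[:0, 1:]" v] by simp
      finally show ?case
        using pCons.IH[OF pCons.prems] by (simp add: \<beta>_def dot_linear Y.T_add Y.T_scale)
    qed
    show "card {s\<in>S. pair.T.act f s = 0} = card {s\<in>S. pair.U.act f s = 0}"
    proof (rule pair.card_kernel_adjoint[where \<beta> = \<beta>])
      show "finite (UNIV :: 'a set)" by simp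
      show "pair.subspace S" "finite S" by (simp_all add: S_def subspace_polys_below finite_polys_below)
      show "u = 0" if u: "u \<in> S" and z: "\<And>v. v \<in> S \<Longrightarrow> \<beta> u v = 0" for u
      proof (rule dot_nondegenerate[of u n])
        fix w :: "'a poly" assume w: "w \<in> polys_below n"
        have "mact Y (mact Z w) = w" using c ZY w by (simp add: mact_one flip: mact_mult)
        then show "dot n u w = 0"
          using z[of "mact Z w"] ZY(1) by (simp add: S_def \<beta>_def mact_in_polys_below)
      qed (use u in \<open>simp add: S_def\<close>)
      show "v = 0" if v: "v \<in> S" and z: "\<And>u. u \<in> S \<Longrightarrow> \<beta> u v = 0" for v
      proof -
        have "mact Y v = 0"
          by (rule dot_nondegenerate[of _ n])
            (use z c in \<open>auto simp: S_def \<beta>_def dot_commute mact_in_polys_below\<close>)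
        moreover have "mact Z (mact Y v) = v" using c ZY v by (simp add: S_def mact_one flip: mact_mult)
        ultimately show ?thesis using endomorphism.T_0[OF endomorphism_mact, of Z] by simp
      qed
      show "pair.T.act f u \<in> S" "pair.U.act f u \<in> S" if "u \<in> S" for u
        using inv that by (simp_all add: pair.inv_stable_def pair.T.act_closed pair.U.act_closed)
      show "\<beta> (pair.T.act f u) v = \<beta> u (pair.U.act f v)" if "u \<in> S" "v \<in> S" for u v
        using that(2) by (rule adj)
    qed (simp_all add: \<beta>_def dot_linear Y.T_add Y.T_scale)
  qed
  obtain ms where ms: "length ms = n" "\<forall>m\<in>set ms. self_recip m" "sorted_wrt (\<lambda>a b. b dvd a) ms"
    "card S = CARD('a) ^ (\<Sum>m\<leftarrow>ms. degree m)" "pair.T.decomp ms S"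
    using pair.ex_self_recip_decomp[OF _ inv bal, of n] by (auto simp: S_def card_polys_below)
  have "CARD('a) \<ge> 2" using card_mono[of UNIV "{0 :: 'a, 1}"] by simp
  then have "(\<Sum>m\<leftarrow>ms. degree m) = n" using ms(4) by (simp add: S_def card_polys_below)
  then show ?thesis using ms by (auto simp: S_def)
qed

text \<open>An isomorphism of the two modules is linear on coordinates, hence a matrix
  \<open>P\<close>, invertible because the inverse map is linear too; commuting with the operators
  becomes the intertwining equation.\<close>

lemma similar_if_decomp:
  fixes g g' :: "'a::{field,finite} mat"
  assumes g: "g \<in> carrier_mat n n" "endomorphism.decomp smult (mact g) ms (polys_below n)"
    and g': "g' \<in> carrier_mat n n" "endomorphism.decomp smult (mact g') ms (polys_below n)"
  shows "\<exists>P \<in> carrier (GL TYPE('a) n). P * g = g' * P"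
proof -
  let ?S = "polys_below n :: 'a poly set"
  obtain h where h: "bij_betw h ?S ?S" and add: "\<And>x y. x \<in> ?S \<Longrightarrow> y \<in> ?S \<Longrightarrow> h (x + y) = h x + h y"
    and scale: "\<And>a x. x \<in> ?S \<Longrightarrow> h (smult a x) = smult a (h x)"
    and comm: "\<And>x. x \<in> ?S \<Longrightarrow> h (mact g x) = mact g' (h x)"
    using decomp_isomorphic[OF endomorphism_mact endomorphism_mact stable_mact[OF g(1)] g(2)
        stable_mact[OF g'(1)] g'(2)] by blast
  define k where "k = the_inv_into ?S h"
  have hS: "h x \<in> ?S" and kS: "k x \<in> ?S" and kh: "k (h x) = x" and hk: "h (k x) = x" if "x \<in> ?S" for x
    using that h bij_betw_the_inv_into[OF h]
    by (auto simp: k_def bij_betw_def the_inv_into_f_f f_the_inv_into_f)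
  obtain P where P: "P \<in> carrier_mat n n" "\<And>x. x \<in> ?S \<Longrightarrow> mact P x = h x"
    using ex_mact[OF hS add scale] by blast
  have k_add: "k (x + y) = k x + k y" if "x \<in> ?S" "y \<in> ?S" for x y
  proof -
    have "x + y = h (k x + k y)" using that add kS hk by simp
    then show ?thesis using kh[OF polys_below_add] kS that by metis
  qed
  have k_scale: "k (smult a x) = smult a (k x)" if "x \<in> ?S" for a x
  proof -
    have "smult a x = h (smult a (k x))" using that scale kS hk by simp
    then show ?thesis using kh[OF polys_below_smult] kS that by metis
  qed
  obtain Q where Q: "Q \<in> carrier_mat n n" "\<And>x. x \<in> ?S \<Longrightarrow> mact Q x = k x"
    using ex_mact[OF kS k_add k_scale] by blast
  have "P * Q = 1\<^sub>m n" "Q * P = 1\<^sub>m n"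
    by (rule mact_inject[of _ n]; use P Q hS kS hk kh in \<open>simp add: mact_mult[of _ n] mact_one\<close>)+
  then have "P \<in> carrier (GL TYPE('a) n)"
    using P(1) Q(1) by (auto simp: carrier_GL Units_def ring_mat_simps)
  moreover have "P * g = g' * P"
    by (rule mact_inject[of _ n])
      (use P g(1) g'(1) comm in \<open>auto simp: mact_mult[of _ n] mact_in_polys_below\<close>)
  ultimately show ?thesis by blast
qed

section \<open>Counting self-reciprocal polynomials\<close>

lemma coeff_self_recip:
  assumes "self_recip f" "i \<le> degree f"
  shows "coeff f (degree f - i) = coeff f 0 * coeff f i"
proof -
  have "coeff (reflect_poly f) i = coeff f 0 * coeff f i" using assms(1) by (simp add: self_recip_def)
  then show ?thesis using assms(2) by (simp add: coeff_reflect_poly)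
qed

lemma self_recip_coeff_0:
  assumes "self_recip f"
  shows "coeff f 0 = 1 \<or> coeff f 0 = -1"
proof -
  have "coeff f 0 * coeff f 0 = 1" using coeff_self_recip[OF assms, of 0] assms by (simp add: self_recip_def)
  then show ?thesis by (simp add: square_eq_1_iff)
qed

lemma finite_self_recip_degree_le: "finite {f :: 'a::{field,finite} poly. self_recip f \<and> degree f \<le> d}"
proof (rule finite_subset)
  show "{f :: 'a poly. self_recip f \<and> degree f \<le> d} \<subseteq> polys_below (Suc d)"
    by (auto simp: polys_below_iff)
qed (rule finite_polys_below)

lemma finite_self_recip_degree: "finite {f :: 'a::{field,finite} poly. self_recip f \<and> degree f = d}"
  by (rule finite_subset[OF _ finite_self_recip_degree_le[of d]]) auto

text \<open>\<open>I\<close> collects the free positions in the lower half. The constant term is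
  fixed, and the symmetry determines the upper half from the lower one.\<close>

lemma card_self_recip_le:
  assumes eq: "\<And>f. f \<in> F \<Longrightarrow> self_recip f \<and> degree f = d \<and> coeff f 0 = c"
    and I: "finite I" "\<And>f i. f \<in> F \<Longrightarrow> 0 < i \<Longrightarrow> i \<le> d div 2 \<Longrightarrow> i \<notin> I \<Longrightarrow> coeff f i = 0"
  shows "card (F :: 'a::{field,finite} poly set) \<le> CARD('a) ^ card I"
proof -
  have inj: "inj_on (\<lambda>f. restrict (coeff f) I) F"
  proof (rule inj_onI, rule poly_eqI)
    fix f g i assume fg: "f \<in> F" "g \<in> F" "restrict (coeff f) I = restrict (coeff g) I"
    have low: "coeff f i = coeff g i" if "i \<le> d div 2" for i
      using that eq[OF fg(1)] eq[OF fg(2)] I(2)[OF fg(1)] I(2)[OF fg(2)] fun_cong[OF fg(3), of i]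
      by (cases "i = 0"; cases "i \<in> I") auto
    show "coeff f i = coeff g i"
    proof (cases "i \<le> d")
      case True
      show ?thesis
      proof (cases "i \<le> d div 2")
        case False
        then have "coeff f (d - i) = coeff g (d - i)" by (intro low) simp
        then show ?thesis
          using coeff_self_recip[of f "d - i"] coeff_self_recip[of g "d - i"] eq[OF fg(1)] eq[OF fg(2)] True
          by simp
      qed (rule low)
    qed (use eq[OF fg(1)] eq[OF fg(2)] in \<open>simp add: coeff_eq_0\<close>)
  qed
  have "card F \<le> card (I \<rightarrow>\<^sub>E (UNIV :: 'a set))"
    by (rule card_inj_on_le[OF inj]) (auto simp: finite_PiE I(1))
  then show ?thesis by (simp add: card_PiE I(1))
qed

text \<open>Negation permutes the nonzero elements, so it leaves their product unchanged. For a
  field of even size the exponent is odd, whence -1 = 1.\<close>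

lemma minus_one_power_card_units: "(- 1 :: 'a::{field,finite}) ^ (CARD('a) - 1) = 1"
proof -
  let ?N = "UNIV - {0 :: 'a}"
  have "bij_betw uminus ?N ?N" by (rule bij_betwI[where g = uminus]) auto
  then have "(\<Prod>x\<in>?N. - x) = \<Prod>?N" by (rule prod.reindex_bij_betw)
  then have "(- 1) ^ card ?N * \<Prod>?N = \<Prod>?N" by (simp add: prod_uminus)
  moreover have "\<Prod>?N \<noteq> 0" by simp
  moreover have "card ?N = CARD('a) - 1" by (subst card_Diff_subset) auto
  ultimately show ?thesis by (metis mult_cancel_right2)
qed

lemma card_self_recip_even:
  assumes "even CARD('a::{field,finite})"
  shows "card {f :: 'a poly. self_recip f \<and> degree f = d} \<le> CARD('a) ^ (d div 2)"
proof -
  have "odd (CARD('a) - 1)" using assms by (simp add: finite_UNIV_card_ge_0)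
  then have "(- 1 :: 'a) = 1" using minus_one_power_card_units[where 'a = 'a] by simp
  then have "card {f :: 'a poly. self_recip f \<and> degree f = d} \<le> CARD('a) ^ card {1..d div 2}"
    by (intro card_self_recip_le[where c = 1 and d = d]) (use self_recip_coeff_0 in fastforce)+
  then show ?thesis by simp
qed

lemma card_self_recip_0: "card {f :: 'a::{field,finite} poly. self_recip f \<and> degree f = 0} = 1"
proof -
  have "{f :: 'a poly. self_recip f \<and> degree f = 0} = {1}"
    using self_recip_1 by (auto simp: self_recip_def elim!: degree_eq_zeroE)
  then show ?thesis by simp
qed

text \<open>The factor 2 stands for the constant terms 1 and -1. In even degree the middle
  coefficient equals itself times the constant term, so it vanishes when that is -1. One free
  position is lost, and 1 + 1/q \<le> 4/3.\<close>

lemma card_self_recip_odd: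
  assumes "odd CARD('a::{field,finite})"
  shows "card {f :: 'a poly. self_recip f \<and> degree f = d} \<le> 2 * CARD('a) ^ (d div 2)"
    and "even d \<Longrightarrow> d > 0 \<Longrightarrow> 3 * card {f :: 'a poly. self_recip f \<and> degree f = d} \<le> 4 * CARD('a) ^ (d div 2)"
proof -
  define F where "F c = {f :: 'a poly. self_recip f \<and> degree f = d \<and> coeff f 0 = c}" for c
  have "{f :: 'a poly. self_recip f \<and> degree f = d} = F 1 \<union> F (- 1)"
    using self_recip_coeff_0 by (auto simp: F_def)
  then have le: "card {f :: 'a poly. self_recip f \<and> degree f = d} \<le> card (F 1) + card (F (- 1))"
    by (simp add: card_Un_le)
  have Fc: "card (F c) \<le> CARD('a) ^ card {1..d div 2}" for c
    by (rule card_self_recip_le[where c = c and d = d]) (auto simp: F_def)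
  show "card {f :: 'a poly. self_recip f \<and> degree f = d} \<le> 2 * CARD('a) ^ (d div 2)"
    using le Fc[of 1] Fc[of "- 1"] by simp
  assume d: "even d" "d > 0"
  have "CARD('a) \<ge> 2" using card_mono[of UNIV "{0 :: 'a, 1}"] by simp
  then have q: "CARD('a) \<ge> 3" using assms by (cases "CARD('a) = 2") auto
  \<comment> \<open>The shift by 1 preserves the sum of all elements, so the size of the field is 0
    in the field; if 1 + 1 were 0, its being odd would make it 1.\<close>
  have neq: "(1 :: 'a) + 1 \<noteq> 0"
  proof
    assume two: "(1 :: 'a) + 1 = 0"
    have "x + 1 + 1 = x" for x :: 'a using two by (simp add: add.assoc)
    then have "bij_betw (\<lambda>x :: 'a. x + 1) UNIV UNIV" by (intro bij_betwI[where g = "\<lambda>x. x + 1"]) auto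
    then have "(\<Sum>x\<in>UNIV. x + (1 :: 'a)) = \<Sum>UNIV" by (rule sum.reindex_bij_betw)
    then have "of_nat CARD('a) = (0 :: 'a)" by (simp add: sum.distrib)
    moreover have "of_nat CARD('a) = (1 :: 'a)"
    proof -
      obtain k where "CARD('a) = 2 * k + 1" using assms by (rule oddE)
      then show ?thesis using two by (simp add: numeral_2_eq_2)
    qed
    ultimately show False by simp
  qed
  have mid: "coeff f (d div 2) = 0" if "f \<in> F (- 1)" for f
  proof -
    have "coeff f (d - d div 2) = - coeff f (d div 2)"
      using that coeff_self_recip[of f "d div 2"] by (auto simp: F_def)
    moreover have "d - d div 2 = d div 2" using d by auto
    ultimately have "(1 + 1) * coeff f (d div 2) = 0" by (simp add: distrib_right)
    then show ?thesis using neq by (metis mult_eq_0_iff)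
  qed
  have "card (F (- 1)) \<le> CARD('a) ^ card {1..<d div 2}"
  proof (rule card_self_recip_le[where c = "- 1" and d = d])
    show "coeff f i = 0" if "f \<in> F (- 1)" "0 < i" "i \<le> d div 2" "i \<notin> {1..<d div 2}" for f i
    proof -
      have "i = d div 2" using that by auto
      then show ?thesis using mid[OF that(1)] by simp
    qed
  qed (auto simp: F_def)
  then have 1: "card (F (- 1)) \<le> CARD('a) ^ (d div 2 - 1)" by simp
  have "CARD('a) ^ (d div 2) = CARD('a) * CARD('a) ^ (d div 2 - 1)"
    using d by (cases "d div 2") (auto elim: evenE)
  then have "3 * CARD('a) ^ (d div 2 - 1) \<le> CARD('a) ^ (d div 2)" using q by simp
  then show "3 * card {f :: 'a poly. self_recip f \<and> degree f = d} \<le> 4 * CARD('a) ^ (d div 2)"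
    using le Fc[of 1] 1 by simp
qed

section \<open>Counting divisor chains\<close>

fun suffix_prods :: "'a::monoid_mult list \<Rightarrow> 'a list" where
  "suffix_prods [] = []"
| "suffix_prods (g # gs) = (g * prod_list gs) # suffix_prods gs"

text \<open>The starting index is a parameter since the first quotient will be split off, leaving a
  list whose indices begin at 2.\<close>

fun weighted_degree :: "nat \<Rightarrow> 'a::zero poly list \<Rightarrow> nat" where
  "weighted_degree k [] = 0"
| "weighted_degree k (g # gs) = k * degree g + weighted_degree (Suc k) gs"

lemma self_recip_prod_list: "\<forall>g\<in>set gs. self_recip g \<Longrightarrow> self_recip (prod_list gs)"
  by (induction gs) (simp_all add: self_recip_1 self_recip_mult)

lemma weighted_degree_Suc:
  "\<forall>g\<in>set gs. self_recip g \<Longrightarrow> weighted_degree (Suc k) gs = weighted_degree k gs + degree (prod_list gs)"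
  by (induction gs arbitrary: k)
    (simp_all add: degree_mult_eq self_recip_nonzero self_recip_prod_list)

lemma sum_degree_suffix_prods:
  "\<forall>g\<in>set gs. self_recip g \<Longrightarrow> (\<Sum>m\<leftarrow>suffix_prods gs. degree m) = weighted_degree 1 gs"
proof (induction gs)
  case (Cons g gs)
  then show ?case using weighted_degree_Suc[of gs 1]
    by (simp add: degree_mult_eq self_recip_nonzero self_recip_prod_list)
qed simp

lemma ex_suffix_prods:
  assumes "\<forall>m\<in>set ms. self_recip m" "sorted_wrt (\<lambda>a b. b dvd a) ms"
  shows "\<exists>gs. length gs = length ms \<and> (\<forall>g\<in>set gs. self_recip g) \<and> suffix_prods gs = ms"
  using assms
proof (induction ms)
  case (Cons m ms)
  then obtain gs where gs: "length gs = length ms" "\<forall>g\<in>set gs. self_recip g" "suffix_prods gs = ms"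
    by auto
  \<comment> \<open>This product is the head of \<open>ms\<close>, or 1 if \<open>ms\<close> is
    empty.\<close>
  have "prod_list gs dvd m"
  proof (cases gs)
    case (Cons g gs')
    then have "prod_list gs \<in> set ms" using gs(3) by auto
    then show ?thesis using Cons.prems(2) by simp
  qed simp
  then obtain g where g: "m = g * prod_list gs" by (metis dvdE mult.commute)
  then have "self_recip g" using Cons.prems(1) self_recip_prod_list[OF gs(2)] by (metis list.set_intros(1) self_recip_quotient)
  then show ?case using gs g by (intro exI[of _ "g # gs"]) simp
qed simp

lemma degree_le_weighted_degree:
  "g \<in> set gs \<Longrightarrow> k > 0 \<Longrightarrow> degree g \<le> weighted_degree k gs"
  by (induction gs arbitrary: k) (auto intro: trans_le_add1 trans_le_add2)

text \<open>Submultiplicativity of this weight bounds the weighted number of chains by a product.\<close>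

definition weight :: "real \<Rightarrow> nat \<Rightarrow> real" where
  "weight q j = inverse q ^ (j div 2)"

lemma weight_nonneg: "q \<ge> 1 \<Longrightarrow> 0 \<le> weight q j"
  by (simp add: weight_def)

lemma weight_add_le:
  assumes "q \<ge> 1"
  shows "weight q (i + j) \<le> weight q i * weight q j"
proof -
  have "i div 2 + j div 2 \<le> (i + j) div 2" by simp
  then have "inverse q ^ ((i + j) div 2) \<le> inverse q ^ (i div 2 + j div 2)"
    using assms by (intro power_decreasing) (auto simp: field_simps)
  then show ?thesis by (simp add: weight_def power_add)
qed

text \<open>By submultiplicativity the entry at index i contributes at most its own factor
  \<open>weight q (i * degree f)\<close>, so the sum over lists factors index by index.\<close>

lemma sum_weight_le:
  assumes q: "q \<ge> 1" and P: "finite (P :: 'a::field poly set)"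
  shows "(\<Sum>gs | set gs \<subseteq> P \<and> length gs = N. weight q (weighted_degree k gs))
    \<le> (\<Prod>i\<in>{k..<k + N}. \<Sum>f\<in>P. weight q (i * degree f))"
proof (induction N arbitrary: k)
  case 0
  have "{gs :: 'a poly list. set gs \<subseteq> P \<and> length gs = 0} = {[]}" by auto
  then show ?case by (simp add: weight_def)
next
  case (Suc N)
  let ?L = "\<lambda>N. {gs. set gs \<subseteq> P \<and> length gs = N}"
  have "(\<Sum>gs\<in>?L (Suc N). weight q (weighted_degree k gs))
      = (\<Sum>(gs, g)\<in>?L N \<times> P. weight q (weighted_degree k (g # gs)))"
    by (subst lists_length_Suc_eq, subst sum.reindex) (auto simp: inj_on_def case_prod_beta intro!: sum.cong)
  also have "\<dots> = (\<Sum>gs\<in>?L N. \<Sum>g\<in>P. weight q (k * degree g + weighted_degree (Suc k) gs))"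
    by (simp add: sum.cartesian_product)
  also have "\<dots> \<le> (\<Sum>gs\<in>?L N. \<Sum>g\<in>P. weight q (k * degree g) * weight q (weighted_degree (Suc k) gs))"
    by (intro sum_mono weight_add_le q)
  also have "\<dots> = (\<Sum>g\<in>P. weight q (k * degree g)) * (\<Sum>gs\<in>?L N. weight q (weighted_degree (Suc k) gs))"
    by (simp add: sum_product sum.swap[of _ P])
  also have "\<dots> \<le> (\<Sum>g\<in>P. weight q (k * degree g)) * (\<Prod>i\<in>{Suc k..<Suc k + N}. \<Sum>f\<in>P. weight q (i * degree f))"
    using Suc.IH[of "Suc k"] by (intro mult_left_mono sum_nonneg weight_nonneg q) auto
  also have "\<dots> = (\<Prod>i\<in>{k..<k + Suc N}. \<Sum>f\<in>P. weight q (i * degree f))"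
    by (subst (2) prod.atLeast_Suc_lessThan) auto
  finally show ?case .
qed

text \<open>Chains are padded with the constant polynomial 1, so that all of them have length \<open>n\<close>.\<close>

definition chains :: "nat \<Rightarrow> 'a::field poly list set" where
  "chains n = {ms. length ms = n \<and> (\<forall>m\<in>set ms. self_recip m) \<and> sorted_wrt (\<lambda>a b. b dvd a) ms
    \<and> (\<Sum>m\<leftarrow>ms. degree m) = n}"

lemma finite_chains: "finite (chains n :: 'a::{field,finite} poly list set)"
proof (rule finite_subset)
  show "chains n \<subseteq> {ms :: 'a poly list. set ms \<subseteq> {f. self_recip f \<and> degree f \<le> n} \<and> length ms = n}"
  proof
    fix ms :: "'a poly list" assume ms: "ms \<in> chains n"
    have "degree m \<le> n" if "m \<in> set ms" for m
      using ms that member_le_sum_list[of "degree m" "map degree ms"] by (simp add: chains_def)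
    then show "ms \<in> {ms. set ms \<subseteq> {f. self_recip f \<and> degree f \<le> n} \<and> length ms = n}"
      using ms by (auto simp: chains_def)
  qed
qed (rule finite_lists_length_eq[OF finite_self_recip_degree_le])

text \<open>The tail of quotients leaves only the degree of the first one fixed: it is n minus the
  weighted degree D of the tail. The A q^((n - D) div 2) choices cost at most the full power q^(n
  div 2) times the weight of D.\<close>

lemma card_chains_le:
  fixes A :: real
  assumes n: "n \<ge> 1"
    and A: "\<And>d. real (card {f :: 'a::{field,finite} poly. self_recip f \<and> degree f = d}) \<le> A * real CARD('a) ^ (d div 2)"
  defines "P \<equiv> {f :: 'a poly. self_recip f \<and> degree f \<le> n}"
  shows "real (card (chains n :: 'a poly list set))
      \<le> A * real CARD('a) ^ (n div 2) * (\<Prod>i\<in>{2..n}. \<Sum>f\<in>P. weight (real CARD('a)) (i * degree f))"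
proof -
  let ?q = "real CARD('a)"
  have q: "?q \<ge> 1" by (simp add: Suc_le_eq)
  have finP: "finite P" unfolding P_def by (rule finite_self_recip_degree_le)
  define L where "L = {gs. set gs \<subseteq> P \<and> length gs = n - 1}"
  have finL: "finite L" unfolding L_def by (rule finite_lists_length_eq[OF finP])
  define R where "R gs = {f :: 'a poly. self_recip f \<and> degree f = n - weighted_degree 2 gs}" for gs :: "'a poly list"
  define X where "X = (SIGMA gs:{gs\<in>L. weighted_degree 2 gs \<le> n}. R gs)"
  have sub: "chains n \<subseteq> (\<lambda>(gs, g). suffix_prods (g # gs)) ` X"
  proof
    fix ms :: "'a poly list" assume "ms \<in> chains n"
    then have ms: "length ms = n" "\<forall>m\<in>set ms. self_recip m" "sorted_wrt (\<lambda>a b. b dvd a) ms"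
      "(\<Sum>m\<leftarrow>ms. degree m) = n" by (auto simp: chains_def)
    obtain hs where hs: "length hs = n" "\<forall>g\<in>set hs. self_recip g" "suffix_prods hs = ms"
      using ex_suffix_prods[OF ms(2,3)] ms(1) by auto
    have wd: "weighted_degree 1 hs = n" using sum_degree_suffix_prods[OF hs(2)] hs(3) ms(4) by simp
    obtain g gs where gs: "hs = g # gs" using hs(1) n by (cases hs) auto
    have wd': "degree g + weighted_degree 2 gs = n" using wd gs by (simp add: numeral_2_eq_2)
    have "set gs \<subseteq> P" using hs(2) gs degree_le_weighted_degree[of _ gs 2] wd' by (force simp: P_def)
    then have "gs \<in> L" using hs(1) gs by (simp add: L_def)
    then have "(gs, g) \<in> X" using hs(2) gs wd' by (auto simp: X_def R_def)
    then show "ms \<in> (\<lambda>(gs, g). suffix_prods (g # gs)) ` X" using hs(3) gs by force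
  qed
  have finX: "finite X" unfolding X_def R_def
    by (intro finite_SigmaI finite_self_recip_degree) (use finL in simp)
  have R: "real (card (R gs)) \<le> A * ?q ^ (n div 2) * weight ?q (weighted_degree 2 gs)"
    if "weighted_degree 2 gs \<le> n" for gs :: "'a poly list"
  proof -
    let ?D = "weighted_degree 2 gs"
    have A0: "A \<ge> 0" using A[of 0] by (simp add: card_self_recip_0)
    have "(n - ?D) div 2 + ?D div 2 \<le> n div 2" using that by linarith
    then have "?q ^ ((n - ?D) div 2 + ?D div 2) \<le> ?q ^ (n div 2)" using q by (rule power_increasing)
    then have "?q ^ ((n - ?D) div 2) \<le> ?q ^ (n div 2) * weight ?q ?D"
      using q by (simp add: weight_def power_add field_simps)
    then have "A * ?q ^ ((n - ?D) div 2) \<le> A * (?q ^ (n div 2) * weight ?q ?D)"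
      using A0 by (rule mult_left_mono)
    then show ?thesis using A[of "n - ?D"] by (simp add: R_def)
  qed
  have A0: "A \<ge> 0" using A[of 0] by (simp add: card_self_recip_0)
  have "card (chains n :: 'a poly list set) \<le> card X"
    using card_mono[OF _ sub] card_image_le[OF finX] finX by (meson finite_imageI le_trans)
  also have "card X = (\<Sum>gs\<in>{gs\<in>L. weighted_degree 2 gs \<le> n}. card (R gs))"
    unfolding X_def using finL by (intro card_SigmaI) (auto simp: R_def finite_self_recip_degree)
  finally have "real (card (chains n :: 'a poly list set))
      \<le> real (\<Sum>gs\<in>{gs\<in>L. weighted_degree 2 gs \<le> n}. card (R gs))"
    by (rule of_nat_mono)
  also have "\<dots> = (\<Sum>gs\<in>{gs\<in>L. weighted_degree 2 gs \<le> n}. real (card (R gs)))"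
    by (rule of_nat_sum)
  also have "\<dots> \<le> (\<Sum>gs\<in>{gs\<in>L. weighted_degree 2 gs \<le> n}. A * ?q ^ (n div 2) * weight ?q (weighted_degree 2 gs))"
    by (intro sum_mono R) simp
  \<comment> \<open>The constraint on the weighted degree is dropped, as the added terms are
    nonnegative; the unrestricted sum factors.\<close>
  also have "\<dots> \<le> (\<Sum>gs\<in>L. A * ?q ^ (n div 2) * weight ?q (weighted_degree 2 gs))"
    using finL A0 q by (intro sum_mono2) (auto simp: weight_nonneg)
  also have "\<dots> = A * ?q ^ (n div 2) * (\<Sum>gs\<in>L. weight ?q (weighted_degree 2 gs))"
    by (simp add: sum_distrib_left)
  also have "\<dots> \<le> A * ?q ^ (n div 2) * (\<Prod>i\<in>{2..<2 + (n - 1)}. \<Sum>f\<in>P. weight ?q (i * degree f))"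
    unfolding L_def using A0 q by (intro mult_left_mono sum_weight_le finP) auto
  also have "{2..<2 + (n - 1)} = {2..n}" using n by auto
  finally show "real (card (chains n :: 'a poly list set))
      \<le> A * ?q ^ (n div 2) * (\<Prod>i\<in>{2..n}. \<Sum>f\<in>P. weight ?q (i * degree f))" .
qed

section \<open>Bounding the product\<close>

text \<open>Steps of length 2 match exponents \<open>d div 2\<close>, whose growth is regular within
  each parity class. Degree 0 stays outside, since it holds the single polynomial 1. With s the sum
  from 1 on, s \<le> f 1 + f 2 + r * s.\<close>

lemma sum_two_step_geometric:
  fixes f :: "nat \<Rightarrow> real"
  assumes nonneg: "\<And>d. 0 \<le> f d" and step: "\<And>d. d \<ge> 1 \<Longrightarrow> f (d + 2) \<le> r * f d" and r: "0 \<le> r" "r < 1"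
  shows "(\<Sum>d\<le>n. f d) \<le> f 0 + (f 1 + f 2) / (1 - r)"
proof -
  define s where "s = (\<Sum>d\<in>{1..<n + 1}. f d)"
  have "s \<le> (\<Sum>d\<in>{1..<n + 3}. f d)" unfolding s_def by (intro sum_mono2) (auto simp: nonneg)
  also have "\<dots> = f 1 + f 2 + (\<Sum>d\<in>{3..<n + 3}. f d)"
  proof -
    have "{1..<n + 3} = insert 1 (insert 2 {3..<n + 3})" by auto
    then show ?thesis by simp
  qed
  also have "(\<Sum>d\<in>{3..<n + 3}. f d) = (\<Sum>d\<in>{1..<n + 1}. f (d + 2))"
    using sum.shift_bounds_nat_ivl[of f 1 2 "n + 1"] by (simp add: numeral_3_eq_3)
  also have "\<dots> \<le> r * s" unfolding s_def sum_distrib_left by (intro sum_mono step) auto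
  finally have "s * (1 - r) \<le> f 1 + f 2" by (simp add: algebra_simps)
  then have "s \<le> (f 1 + f 2) / (1 - r)" using r by (simp add: pos_le_divide_eq)
  moreover have "(\<Sum>d\<le>n. f d) = f 0 + s"
  proof -
    have "{..n} = insert 0 {1..<n + 1}" by auto
    then show ?thesis by (simp add: s_def)
  qed
  ultimately show ?thesis by simp
qed


text \<open>Here \<open>b\<close> is the smallest admissible \<open>q\<close>, and at most \<open>\<alpha>\<^sub>1 q\<^bsup>\<lfloor>d/2\<rfloor>\<^esup>\<close> resp.
  \<open>\<alpha>\<^sub>2 q\<^bsup>\<lfloor>d/2\<rfloor>\<^esup>\<close> self-reciprocal polynomials have odd resp. even degree \<open>d > 0\<close>.\<close>

definition factor_bound :: "real \<Rightarrow> real \<Rightarrow> real \<Rightarrow> nat \<Rightarrow> real" where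
  "factor_bound b \<alpha>\<^sub>1 \<alpha>\<^sub>2 i = (let y = inverse b ^ (i div 2); c = (if even i then b else 1)
     in 1 + (\<alpha>\<^sub>1 * y + \<alpha>\<^sub>2 * c * y\<^sup>2) / (1 - c * y\<^sup>2))"

text \<open>Grouped by degree, the terms carry a nonnegative power of 1/q, so replacing q by its
  lower bound \<open>b\<close> only enlarges them. The resulting majorant \<open>t\<close> is
  geometric in steps of 2 with ratio \<open>c * y\<^sup>2\<close>.\<close>

lemma sum_weight_degree_le:
  fixes b \<alpha>\<^sub>1 \<alpha>\<^sub>2 :: real
  assumes b: "2 \<le> b" "b \<le> real CARD('a::{field,finite})" and nonneg: "0 \<le> \<alpha>\<^sub>1" "0 \<le> \<alpha>\<^sub>2"
    and odd: "\<And>d. odd d \<Longrightarrow> real (card {f :: 'a poly. self_recip f \<and> degree f = d}) \<le> \<alpha>\<^sub>1 * real CARD('a) ^ (d div 2)"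
    and even: "\<And>d. even d \<Longrightarrow> d > 0 \<Longrightarrow> real (card {f :: 'a poly. self_recip f \<and> degree f = d}) \<le> \<alpha>\<^sub>2 * real CARD('a) ^ (d div 2)"
    and i: "i \<ge> 2"
  shows "(\<Sum>f | self_recip (f :: 'a poly) \<and> degree f \<le> n. weight (real CARD('a)) (i * degree f)) \<le> factor_bound b \<alpha>\<^sub>1 \<alpha>\<^sub>2 i"
proof -
  let ?q = "real CARD('a)"
  define \<alpha> where "\<alpha> d = (if d = 0 then 1 else if odd d then \<alpha>\<^sub>1 else \<alpha>\<^sub>2)" for d :: nat
  define l where "l = i div 2"
  define y where "y = inverse b ^ l"
  define c where "c = (if Parity.even i then b else 1)"
  define t where "t d = \<alpha> d * inverse b ^ ((i * d) div 2 - d div 2)" for d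
  have q: "?q > 0" using b by linarith
  have "l \<ge> 1" using i by (simp add: l_def)
  have expo: "d div 2 \<le> (i * d) div 2" for d
    using mult_le_mono1[of 1 i d] i by (intro div_le_mono) simp
  \<comment> \<open>For i = 2 l the exponent is l d - d div 2, for i = 2 l + 1 it is exactly l d;
    the constant \<open>c\<close> absorbs this difference.\<close>
  have t_eq: "t d = \<alpha> d * (y ^ d * c ^ (d div 2))" for d
  proof (cases "Parity.even i")
    case True
    then have il: "i = 2 * l" by (simp add: l_def)
    have "d div 2 \<le> l * d" using expo[of d] il by (simp add: mult.assoc)
    then have "inverse b ^ (l * d - d div 2) = inverse b ^ (l * d) * b ^ (d div 2)"
      using b by (simp add: power_diff field_simps)
    then show ?thesis using True il by (simp add: t_def y_def c_def mult.assoc flip: power_mult)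
  next
    case False
    then have il: "i = 2 * l + 1" by (simp add: l_def)
    have "(i * d) div 2 = l * d + d div 2" by (simp add: il distrib_right mult.assoc)
    then show ?thesis using False by (simp add: t_def y_def c_def flip: power_mult)
  qed
  have t: "real (card {f :: 'a poly. self_recip f \<and> degree f = d}) * weight ?q (i * d) \<le> t d" for d
  proof -
    have "real (card {f :: 'a poly. self_recip f \<and> degree f = d}) \<le> \<alpha> d * ?q ^ (d div 2)"
      using odd[of d] even[of d] by (simp add: \<alpha>_def card_self_recip_0)
    then have "real (card {f :: 'a poly. self_recip f \<and> degree f = d}) * weight ?q (i * d)
        \<le> \<alpha> d * ?q ^ (d div 2) * weight ?q (i * d)"
      using q by (intro mult_right_mono) (simp_all add: weight_def)
    also have "\<dots> = \<alpha> d * inverse ?q ^ ((i * d) div 2 - d div 2)"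
      using q expo[of d] by (simp add: weight_def power_diff field_simps)
    also have "\<dots> \<le> t d"
      unfolding t_def using b nonneg
      by (intro mult_left_mono power_mono le_imp_inverse_le) (auto simp: \<alpha>_def)
    finally show ?thesis .
  qed
  have "(\<Sum>f | self_recip (f :: 'a poly) \<and> degree f \<le> n. weight ?q (i * degree f))
      = (\<Sum>d\<le>n. \<Sum>f | self_recip (f :: 'a poly) \<and> degree f = d. weight ?q (i * degree f))"
  proof -
    have "(\<Sum>d\<le>n. \<Sum>f\<in>{f\<in>{f :: 'a poly. self_recip f \<and> degree f \<le> n}. degree f = d}. weight ?q (i * degree f))
        = (\<Sum>f | self_recip (f :: 'a poly) \<and> degree f \<le> n. weight ?q (i * degree f))"
      by (rule sum.group) (auto simp: finite_self_recip_degree_le)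
    moreover have "{f\<in>{f :: 'a poly. self_recip f \<and> degree f \<le> n}. degree f = d} = {f. self_recip f \<and> degree f = d}"
      if "d \<le> n" for d using that by auto
    ultimately show ?thesis by (simp cong: sum.cong_simp)
  qed
  also have "\<dots> = (\<Sum>d\<le>n. real (card {f :: 'a poly. self_recip f \<and> degree f = d}) * weight ?q (i * d))"
    by (intro sum.cong refl) simp
  also have "\<dots> \<le> (\<Sum>d\<le>n. t d)" by (intro sum_mono t)
  also have "\<dots> \<le> t 0 + (t 1 + t 2) / (1 - c * y\<^sup>2)"
  proof (rule sum_two_step_geometric)
    show "0 \<le> t d" for d using nonneg b by (simp add: t_def \<alpha>_def)
    have y: "0 < y" "y \<le> inverse b"
      using b \<open>l \<ge> 1\<close> power_decreasing[of 1 l "inverse b"] by (simp_all add: y_def field_simps)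
    have "c * y\<^sup>2 \<le> b * (inverse b)\<^sup>2"
      using y b by (intro mult_mono power_mono) (auto simp: c_def)
    also have "\<dots> = inverse b" using b by (simp add: power2_eq_square)
    also have "\<dots> < 1" using b by (simp add: field_simps)
    finally show "c * y\<^sup>2 < 1" .
    show "0 \<le> c * y\<^sup>2" using b by (simp add: c_def)
    show "t (d + 2) \<le> c * y\<^sup>2 * t d" if "d \<ge> 1" for d
      using that by (simp add: t_eq \<alpha>_def power2_eq_square)
  qed
  also have "\<dots> = factor_bound b \<alpha>\<^sub>1 \<alpha>\<^sub>2 i"
  proof -
    have "t 0 = 1" "t 1 = \<alpha>\<^sub>1 * y" "t 2 = \<alpha>\<^sub>2 * c * y\<^sup>2" by (simp_all add: t_eq \<alpha>_def)
    then show ?thesis by (simp only: factor_bound_def Let_def y_def c_def l_def)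
  qed
  finally show ?thesis .
qed

lemma factor_bound_ge_1:
  assumes "2 \<le> b" "0 \<le> \<alpha>\<^sub>1" "0 \<le> \<alpha>\<^sub>2" "i \<ge> 2"
  shows "1 \<le> factor_bound b \<alpha>\<^sub>1 \<alpha>\<^sub>2 i"
proof -
  define y where "y = inverse b ^ (i div 2)"
  define c where "c = (if even i then b else 1)"
  have y: "0 \<le> y" "y \<le> inverse b"
    using assms power_decreasing[of 1 "i div 2" "inverse b"] by (simp_all add: y_def field_simps)
  have "c * y\<^sup>2 \<le> b * (inverse b)\<^sup>2"
    using y assms by (intro mult_mono power_mono) (auto simp: c_def)
  also have "\<dots> = inverse b" using assms by (simp add: power2_eq_square)
  also have "\<dots> \<le> 1" using assms by (simp add: field_simps)
  finally have "0 \<le> (\<alpha>\<^sub>1 * y + \<alpha>\<^sub>2 * c * y\<^sup>2) / (1 - c * y\<^sup>2)"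
    using y assms by (intro divide_nonneg_nonneg add_nonneg_nonneg mult_nonneg_nonneg) (auto simp: c_def)
  then show ?thesis by (simp add: factor_bound_def Let_def y_def c_def)
qed

lemma factor_bound_pair:
  "factor_bound b \<alpha>\<^sub>1 \<alpha>\<^sub>2 (2 * l) = (let y = inverse b ^ l in 1 + (\<alpha>\<^sub>1 * y + \<alpha>\<^sub>2 * b * y\<^sup>2) / (1 - b * y\<^sup>2))"
  "factor_bound b \<alpha>\<^sub>1 \<alpha>\<^sub>2 (2 * l + 1) = (let y = inverse b ^ l in 1 + (\<alpha>\<^sub>1 * y + \<alpha>\<^sub>2 * y\<^sup>2) / (1 - y\<^sup>2))"
  by (simp_all add: factor_bound_def Let_def)

text \<open>A telescoping majorant: \<open>K (1 - 2 b\<^sup>-\<^sup>M)\<close> grows at least as fast as the partial products.\<close>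

lemma prod_factor_bound_le:
  assumes b: "2 \<le> b" "0 \<le> \<alpha>\<^sub>1" "0 \<le> \<alpha>\<^sub>2" and K: "0 \<le> K"
    and base: "(\<Prod>i\<in>{2..5}. factor_bound b \<alpha>\<^sub>1 \<alpha>\<^sub>2 i) \<le> K * (1 - 2 * (inverse b)\<^sup>2)"
    and step: "\<And>y l. y = inverse b ^ l \<Longrightarrow> 0 < y \<Longrightarrow> y \<le> 1 / 8 \<Longrightarrow>
      (1 - 2 * b * y) * (factor_bound b \<alpha>\<^sub>1 \<alpha>\<^sub>2 (2 * l) * factor_bound b \<alpha>\<^sub>1 \<alpha>\<^sub>2 (2 * l + 1)) \<le> 1 - 2 * y"
  shows "(\<Prod>i\<in>{2..n}. factor_bound b \<alpha>\<^sub>1 \<alpha>\<^sub>2 i) \<le> K"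
proof -
  let ?f = "factor_bound b \<alpha>\<^sub>1 \<alpha>\<^sub>2"
  have f1: "1 \<le> ?f i" if "i \<ge> 2" for i using factor_bound_ge_1[OF b that] .
  \<comment> \<open>The induction starts at 2 because for b = 2 the majorant vanishes at M = 1. Each
    step then involves \<open>inverse b\<close> to a power of at least 3, which explains the bound
    1/8.\<close>
  have main: "(\<Prod>i\<in>{2..2 * M + 1}. ?f i) \<le> K * (1 - 2 * inverse b ^ M)" if "M \<ge> 2" for M
    using that
  proof (induction M rule: dec_induct)
    case base
    then show ?case using assms(5) by simp
  next
    case (step M)
    let ?y = "inverse b ^ Suc M"
    have y: "0 < ?y" using b by simp
    have "?y \<le> (1 / 2) ^ Suc M" using b by (intro power_mono) (auto simp: field_simps)
    also have "\<dots> \<le> (1 / 2) ^ 3" using step.hyps by (intro power_decreasing) auto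
    finally have y8: "?y \<le> 1 / 8" by (simp add: power3_eq_cube)
    have "(\<Prod>i\<in>{2..2 * Suc M + 1}. ?f i) = (\<Prod>i\<in>{2..2 * M + 1}. ?f i) * (?f (2 * Suc M) * ?f (2 * Suc M + 1))"
      using step.hyps by (simp add: mult.assoc)
    also have "\<dots> \<le> K * (1 - 2 * inverse b ^ M) * (?f (2 * Suc M) * ?f (2 * Suc M + 1))"
      using step.IH f1[of "2 * Suc M"] f1[of "2 * Suc M + 1"] step.hyps by (intro mult_right_mono) auto
    also have "\<dots> = K * ((1 - 2 * b * ?y) * (?f (2 * Suc M) * ?f (2 * Suc M + 1)))"
      using b by simp
    also have "\<dots> \<le> K * (1 - 2 * ?y)" by (intro mult_left_mono assms(6) y y8 K refl)
    finally show ?case .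
  qed
  have "(\<Prod>i\<in>{2..n}. ?f i) \<le> (\<Prod>i\<in>{2..2 * (n + 2) + 1}. ?f i)"
    using f1 by (intro prod_mono2) (auto intro: order_trans[of 0 1])
  also have "\<dots> \<le> K * (1 - 2 * inverse b ^ (n + 2))" by (rule main) simp
  also have "\<dots> \<le> K" using K b by (simp add: algebra_simps)
  finally show ?thesis .
qed

text \<open>The factors for i = 2, ..., 5 are 3, 2, 10/7 and 4/3, with product 80/7, below the
  required 28 / 2 = 14.\<close>

lemma prod_factor_bound_even: "(\<Prod>i\<in>{2..n}. factor_bound 2 1 1 i) \<le> 28"
proof (rule prod_factor_bound_le)
  have "{2..5} = {2, 3, 4, 5 :: nat}" by auto
  then show "(\<Prod>i\<in>{2..5}. factor_bound 2 1 1 i) \<le> 28 * (1 - 2 * (inverse 2)\<^sup>2)"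
    by (simp add: factor_bound_def Let_def power2_eq_square)
  fix y :: real and l :: nat
  assume yl: "y = inverse 2 ^ l" and y: "0 < y" "y \<le> 1 / 8"
  have y2: "y\<^sup>2 \<le> 1 / 64" using y power_mono[of y "1 / 8" 2] by (simp add: power2_eq_square)
  have "factor_bound 2 1 1 (2 * l) = (1 + y) / (1 - 2 * y\<^sup>2)"
    unfolding factor_bound_pair Let_def yl[symmetric] using y2 by (simp add: field_simps)
  moreover have "factor_bound 2 1 1 (2 * l + 1) = 1 / (1 - y)"
  proof -
    have "1 - y\<^sup>2 = (1 - y) * (1 + y)" by (simp add: power2_eq_square algebra_simps)
    then show ?thesis
      unfolding factor_bound_pair Let_def yl[symmetric] using y y2 by (simp add: field_simps power2_eq_square)
  qed
  \<comment> \<open>The two sides agree up to first order in \<open>y\<close>, which is what the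
    coefficient 2 in the majorant achieves; the difference starts with 4 y^2.\<close>
  moreover have "(1 - 2 * 2 * y) * (1 + y) \<le> (1 - 2 * y) * ((1 - 2 * y\<^sup>2) * (1 - y))"
  proof -
    have "(1 - 2 * y) * ((1 - 2 * y\<^sup>2) * (1 - y)) - (1 - 2 * 2 * y) * (1 + y) = y\<^sup>2 * (4 + 6 * y - 4 * y\<^sup>2)"
      by (simp add: power2_eq_square algebra_simps)
    moreover have "0 \<le> y\<^sup>2 * (4 + 6 * y - 4 * y\<^sup>2)" using y y2 by (intro mult_nonneg_nonneg) auto
    ultimately show ?thesis by linarith
  qed
  ultimately show "(1 - 2 * 2 * y) * (factor_bound 2 1 1 (2 * l) * factor_bound 2 1 1 (2 * l + 1)) \<le> 1 - 2 * y"
    using y y2 by (simp add: pos_divide_le_eq)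
qed simp_all

text \<open>The factors for i = 2, ..., 5 are 8/3, 23/12, 50/39 and 149/120. Their product is about
  8.14, below (23/2)(7/9), which is about 8.94.\<close>

lemma prod_factor_bound_odd: "(\<Prod>i\<in>{2..n}. factor_bound 3 2 (4 / 3) i) \<le> 23 / 2"
proof (rule prod_factor_bound_le)
  have "{2..5} = {2, 3, 4, 5 :: nat}" by auto
  then show "(\<Prod>i\<in>{2..5}. factor_bound 3 2 (4 / 3) i) \<le> 23 / 2 * (1 - 2 * (inverse 3)\<^sup>2)"
    by (simp add: factor_bound_def Let_def power2_eq_square)
  fix y :: real and l :: nat
  assume yl: "y = inverse 3 ^ l" and y: "0 < y" "y \<le> 1 / 8"
  have y2: "y\<^sup>2 \<le> 1 / 64" using y power_mono[of y "1 / 8" 2] by (simp add: power2_eq_square)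
  have "factor_bound 3 2 (4 / 3) (2 * l) = (1 + y)\<^sup>2 / (1 - 3 * y\<^sup>2)"
    unfolding factor_bound_pair Let_def yl[symmetric] using y2 by (simp add: field_simps power2_eq_square)
  moreover have "factor_bound 3 2 (4 / 3) (2 * l + 1) = (1 + 2 * y + y\<^sup>2 / 3) / (1 - y\<^sup>2)"
    unfolding factor_bound_pair Let_def yl[symmetric] using y2 by (simp add: field_simps power2_eq_square)
  \<comment> \<open>Again constant and linear terms cancel, as the pair of factors is 1 + 4 y to
    first order, like (1 - 2 y) / (1 - 6 y).\<close>
  moreover have "(1 - 2 * 3 * y) * ((1 + y)\<^sup>2 * (1 + 2 * y + y\<^sup>2 / 3)) \<le> (1 - 2 * y) * ((1 - 3 * y\<^sup>2) * (1 - y\<^sup>2))"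
  proof -
    have "(1 - 2 * y) * ((1 - 3 * y\<^sup>2) * (1 - y\<^sup>2)) - (1 - 2 * 3 * y) * ((1 + y)\<^sup>2 * (1 + 2 * y + y\<^sup>2 / 3))
        = y\<^sup>2 * (44 / 3 + 112 / 3 * y + 56 / 3 * y\<^sup>2 - 4 * y\<^sup>2 * y)"
      by (simp add: power2_eq_square field_simps)
    moreover have "4 * y\<^sup>2 * y \<le> 4 * (1 / 64) * 1" using y y2 by (intro mult_mono) auto
    then have "0 \<le> y\<^sup>2 * (44 / 3 + 112 / 3 * y + 56 / 3 * y\<^sup>2 - 4 * y\<^sup>2 * y)"
      using y zero_le_power2[of y] by (intro mult_nonneg_nonneg, simp) linarith
    ultimately show ?thesis by linarith
  qed
  ultimately show "(1 - 2 * 3 * y) * (factor_bound 3 2 (4 / 3) (2 * l) * factor_bound 3 2 (4 / 3) (2 * l + 1)) \<le> 1 - 2 * y"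
    using y y2 by (simp add: pos_divide_le_eq)
qed simp_all

section \<open>Explicit bounds for the number of chains\<close>

lemma card_chains_factor_bound:
  assumes n: "n \<ge> 1" and b: "2 \<le> b" "b \<le> real CARD('a::{field,finite})"
    and A: "\<And>d. real (card {f :: 'a poly. self_recip f \<and> degree f = d}) \<le> A * real CARD('a) ^ (d div 2)"
    and odd: "\<And>d. odd d \<Longrightarrow> real (card {f :: 'a poly. self_recip f \<and> degree f = d}) \<le> \<alpha>\<^sub>1 * real CARD('a) ^ (d div 2)"
    and even: "\<And>d. even d \<Longrightarrow> d > 0 \<Longrightarrow> real (card {f :: 'a poly. self_recip f \<and> degree f = d}) \<le> \<alpha>\<^sub>2 * real CARD('a) ^ (d div 2)"
    and nonneg: "0 \<le> \<alpha>\<^sub>1" "0 \<le> \<alpha>\<^sub>2" and K: "(\<Prod>i\<in>{2..n}. factor_bound b \<alpha>\<^sub>1 \<alpha>\<^sub>2 i) \<le> K"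
  shows "real (card (chains n :: 'a poly list set)) \<le> A * K * real CARD('a) ^ (n div 2)"
proof -
  let ?q = "real CARD('a)"
  let ?P = "{f :: 'a poly. self_recip f \<and> degree f \<le> n}"
  have q: "?q \<ge> 1" by (simp add: Suc_le_eq)
  have A0: "A \<ge> 0" using A[of 0] by (simp add: card_self_recip_0)
  have "(\<Prod>i\<in>{2..n}. \<Sum>f\<in>?P. weight ?q (i * degree f)) \<le> (\<Prod>i\<in>{2..n}. factor_bound b \<alpha>\<^sub>1 \<alpha>\<^sub>2 i)"
    using sum_weight_degree_le[OF b nonneg odd even] by (intro prod_mono) (auto intro: sum_nonneg weight_nonneg q)
  then have "(\<Prod>i\<in>{2..n}. \<Sum>f\<in>?P. weight ?q (i * degree f)) \<le> K" using K by linarith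
  then have "A * ?q ^ (n div 2) * (\<Prod>i\<in>{2..n}. \<Sum>f\<in>?P. weight ?q (i * degree f)) \<le> A * ?q ^ (n div 2) * K"
    using A0 by (intro mult_left_mono) auto
  then show ?thesis using card_chains_le[OF n A] by (simp add: mult_ac)
qed

lemma card_chains_even:
  assumes n: "n \<ge> 1" and q: "even CARD('a::{field,finite})"
  shows "card (chains n :: 'a poly list set) \<le> 28 * CARD('a) ^ (n div 2)"
proof -
  have "CARD('a) \<ge> 2" using card_mono[of UNIV "{0 :: 'a, 1}"] by simp
  moreover have "real (card {f :: 'a poly. self_recip f \<and> degree f = d}) \<le> 1 * real CARD('a) ^ (d div 2)" for d
    using card_self_recip_even[OF q, of d] by (metis mult_1 of_nat_le_iff of_nat_power)
  ultimately have "real (card (chains n :: 'a poly list set)) \<le> 1 * 28 * real CARD('a) ^ (n div 2)"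
    by (intro card_chains_factor_bound[OF n, of 2 1 1 1] prod_factor_bound_even) auto
  then have "real (card (chains n :: 'a poly list set)) \<le> real (28 * CARD('a) ^ (n div 2))" by simp
  then show ?thesis by (simp only: of_nat_le_iff)
qed

lemma card_chains_odd:
  assumes n: "n \<ge> 1" and q: "odd CARD('a::{field,finite})"
  shows "card (chains n :: 'a poly list set) \<le> 23 * CARD('a) ^ (n div 2)"
proof -
  have "CARD('a) \<ge> 2" using card_mono[of UNIV "{0 :: 'a, 1}"] by simp
  then have "CARD('a) \<ge> 3" using q by (cases "CARD('a) = 2") auto
  then have q3: "3 \<le> real CARD('a)" by linarith
  have A: "real (card {f :: 'a poly. self_recip f \<and> degree f = d}) \<le> 2 * real CARD('a) ^ (d div 2)" for d
  proof -
    have "real (card {f :: 'a poly. self_recip f \<and> degree f = d}) \<le> real (2 * CARD('a) ^ (d div 2))"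
      using card_self_recip_odd(1)[OF q, of d] by (rule of_nat_mono)
    then show ?thesis by simp
  qed
  have B: "real (card {f :: 'a poly. self_recip f \<and> degree f = d}) \<le> 4 / 3 * real CARD('a) ^ (d div 2)"
    if "even d" "d > 0" for d
  proof -
    have "real (3 * card {f :: 'a poly. self_recip f \<and> degree f = d}) \<le> real (4 * CARD('a) ^ (d div 2))"
      using card_self_recip_odd(2)[OF q that] by (rule of_nat_mono)
    then show ?thesis by simp
  qed
  have "real (card (chains n :: 'a poly list set)) \<le> 2 * (23 / 2) * real CARD('a) ^ (n div 2)"
    by (rule card_chains_factor_bound[OF n _ q3 A A B _ _ prod_factor_bound_odd]) auto
  then have "real (card (chains n :: 'a poly list set)) \<le> real (23 * CARD('a) ^ (n div 2))" by simp
  then show ?thesis by (simp only: of_nat_le_iff)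
qed

section \<open>Classes in the coset and divisor chains\<close>

lemma card_image_le_if_factors:
  assumes "finite (f ` A)" and "\<And>x y. x \<in> A \<Longrightarrow> y \<in> A \<Longrightarrow> f x = f y \<Longrightarrow> g x = g y"
  shows "card (g ` A) \<le> card (f ` A)"
proof -
  define h where "h z = g (SOME y. y \<in> A \<and> f y = z)" for z
  have h: "h (f x) = g x" if x: "x \<in> A" for x
  proof -
    have "(SOME y. y \<in> A \<and> f y = f x) \<in> A \<and> f (SOME y. y \<in> A \<and> f y = f x) = f x"
      by (rule someI[of _ x]) (simp add: x)
    then show ?thesis unfolding h_def using assms(2) x by blast
  qed
  have "g ` A = h ` f ` A" unfolding image_image by (rule image_cong[OF refl]) (simp add: h)
  then show ?thesis using card_image_le[OF assms(1), of h] by simp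
qed

lemma (in group) orbit_conj_eq:
  assumes "a \<in> carrier G" "x \<in> carrier G"
  shows "orbit G (\<lambda>g x. g \<otimes> x \<otimes> inv g) (a \<otimes> x \<otimes> inv a) = orbit G (\<lambda>g x. g \<otimes> x \<otimes> inv g) x"
proof -
  have "\<exists>h\<in>carrier G. g \<otimes> (a \<otimes> x \<otimes> inv a) \<otimes> inv g = h \<otimes> x \<otimes> inv h" if "g \<in> carrier G" for g
    using that assms by (intro bexI[of _ "g \<otimes> a"]) (simp_all add: m_assoc inv_mult_group)
  moreover have "\<exists>h\<in>carrier G. g \<otimes> x \<otimes> inv g = h \<otimes> (a \<otimes> x \<otimes> inv a) \<otimes> inv h" if "g \<in> carrier G" for g
  proof (intro bexI[of _ "g \<otimes> inv a"])
    have "inv a \<otimes> (a \<otimes> y) = y" if "y \<in> carrier G" for y using that assms by (simp flip: m_assoc)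
    then show "g \<otimes> x \<otimes> inv g = (g \<otimes> inv a) \<otimes> (a \<otimes> x \<otimes> inv a) \<otimes> inv (g \<otimes> inv a)"
      using that assms by (simp add: m_assoc inv_mult_group)
  qed (use that assms in simp)
  ultimately show ?thesis unfolding orbit_def by blast
qed

lemma orbits_eq_image: "orbits G E \<phi> = orbit G \<phi> ` E"
  by (auto simp: orbits_def)

lemma inv_GL_plus:
  assumes "h \<in> carrier (GL TYPE('a::field) n)"
  shows "inv\<^bsub>GL_plus TYPE('a) n\<^esub> (h, False) = (inv\<^bsub>GL TYPE('a) n\<^esub> h, False)"
proof -
  interpret G: group "GL TYPE('a) n" by (rule group_GL)
  interpret group "GL_plus TYPE('a) n" by (rule group_GL_plus)
  show ?thesis
    by (rule inv_equality) (use assms in \<open>simp_all add: GL_plus_def split_ext_def\<close>)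
qed

text \<open>Conjugation by \<open>(g, False)\<close> is the twisted action on the first component,
  so each twisted class lies inside one class of the coset.\<close>

lemma k_GL_tau_le_twisted_classes:
  fixes n :: nat
  defines "G \<equiv> GL TYPE('a::{field,finite}) n"
  shows "k_GL_tau TYPE('a) n
    \<le> card (orbits G (carrier G) (\<lambda>g x. g \<otimes>\<^bsub>G\<^esub> x \<otimes>\<^bsub>G\<^esub> inv\<^bsub>G\<^esub> (inv_transpose TYPE('a) n g)))"
proof -
  interpret group G unfolding G_def by (rule group_GL)
  let ?Gp = "GL_plus TYPE('a) n" and ?\<sigma> = "inv_transpose TYPE('a) n"
  interpret p: group ?Gp by (rule group_GL_plus)
  interpret h: group_hom G G ?\<sigma> unfolding G_def
    by (simp add: group_hom_def group_hom_axioms_def group_GL inv_transpose_hom)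
  let ?c = "\<lambda>g x. g \<otimes>\<^bsub>?Gp\<^esub> x \<otimes>\<^bsub>?Gp\<^esub> inv\<^bsub>?Gp\<^esub> g" and ?t = "\<lambda>g x. g \<otimes>\<^bsub>G\<^esub> x \<otimes>\<^bsub>G\<^esub> inv\<^bsub>G\<^esub> (?\<sigma> g)"
  have fin: "finite (carrier G)" unfolding G_def
    by (rule finite_subset[OF _ finite_carrier_mat_finite[of n n]]) (auto simp: carrier_GL_iff)
  interpret t: group_action G "carrier G" "\<lambda>g. restrict (?t g) (carrier G)"
    by (rule group_actionI) (simp_all add: inv_mult_group m_assoc)
  have conj: "?c (g, False) (x, True) = (?t g x, True)" if "g \<in> carrier G" "x \<in> carrier G" for g x
    using that inv_GL_plus[of g n] by (simp add: G_def[symmetric] GL_plus_def split_ext_def)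
  have carr: "(g, s) \<in> carrier ?Gp" if "g \<in> carrier G" for g s
    using that by (simp add: GL_plus_def split_ext_def G_def)
  have "conj_classes ?Gp (GL_tau TYPE('a) n) = (\<lambda>x. orbit ?Gp ?c (x, True)) ` carrier G"
    by (auto simp: conj_classes_def orbits_eq_image GL_tau_eq G_def)
  moreover have "card ((\<lambda>x. orbit ?Gp ?c (x, True)) ` carrier G) \<le> card (orbit G ?t ` carrier G)"
  proof (rule card_image_le_if_factors)
    fix x y assume xy: "x \<in> carrier G" "y \<in> carrier G" "orbit G ?t x = orbit G ?t y"
    have "x \<in> orbit G ?t x" using t.orbit_refl[OF xy(1)] xy(1) by (simp add: orbit_restrict)
    then obtain g where g: "g \<in> carrier G" "x = ?t g y" using xy(3) by (auto simp: orbit_def)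
    then have "(x, True) = ?c (g, False) (y, True)" using conj xy(2) by simp
    then show "orbit ?Gp ?c (x, True) = orbit ?Gp ?c (y, True)"
      using p.orbit_conj_eq[OF carr[OF g(1)] carr[OF xy(2)]] by simp
  qed (use fin in simp)
  ultimately show ?thesis by (simp add: k_GL_tau_def orbits_eq_image)
qed

text \<open>For the inverse transpose automorphism, \<open>E\<close> consists of the
  \<open>g\<close> that fix some \<open>x\<close> under congruence. Such \<open>g\<close> are
  isometries of the form with matrix the inverse of \<open>x\<close>, and equal chains make two of
  them conjugate.\<close>

lemma k_GL_tau_le_card_chains:
  "k_GL_tau TYPE('a::{field,finite}) n \<le> card (chains n :: 'a poly list set)"
proof -
  define G where "G = GL TYPE('a) n"
  interpret group G unfolding G_def by (rule group_GL)
  let ?\<sigma> = "inv_transpose TYPE('a) n"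
  have fin: "finite (carrier G)" unfolding G_def
    by (rule finite_subset[OF _ finite_carrier_mat_finite[of n n]]) (auto simp: carrier_GL_iff)
  define E where "E = {g \<in> carrier G. \<exists>x\<in>carrier G. g \<otimes>\<^bsub>G\<^esub> x \<otimes>\<^bsub>G\<^esub> inv\<^bsub>G\<^esub> (?\<sigma> g) = x}"
  let ?c = "\<lambda>g x. g \<otimes>\<^bsub>G\<^esub> x \<otimes>\<^bsub>G\<^esub> inv\<^bsub>G\<^esub> g"
  have chain: "\<exists>ms. ms \<in> chains n \<and> endomorphism.decomp smult (mact g) ms (polys_below n)" if g: "g \<in> E" for g
  proof -
    obtain x where gx: "g \<in> carrier G" "x \<in> carrier G" "g \<otimes>\<^bsub>G\<^esub> x \<otimes>\<^bsub>G\<^esub> inv\<^bsub>G\<^esub> (?\<sigma> g) = x" using g by (auto simp: E_def)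
    have gT: "transpose_mat g \<in> carrier G" using gx(1) GL_transpose(1) by (simp add: G_def)
    have "inv\<^bsub>G\<^esub> (?\<sigma> g) = transpose_mat g" using gT by (simp add: inv_transpose_def flip: G_def)
    then have eq: "g \<otimes>\<^bsub>G\<^esub> x \<otimes>\<^bsub>G\<^esub> transpose_mat g = x" using gx(3) by simp
    \<comment> \<open>Inverting the fixed-point equation moves the transpose to the left, the shape
      of an isometry of the inverse form.\<close>
    have "transpose_mat g \<otimes>\<^bsub>G\<^esub> inv\<^bsub>G\<^esub> x \<otimes>\<^bsub>G\<^esub> g = inv\<^bsub>G\<^esub> x"
    proof -
      have cancel: "a \<otimes>\<^bsub>G\<^esub> (inv\<^bsub>G\<^esub> a \<otimes>\<^bsub>G\<^esub> b) = b" if "a \<in> carrier G" "b \<in> carrier G" for a b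
        using that by (simp flip: m_assoc)
      have "inv\<^bsub>G\<^esub> x = inv\<^bsub>G\<^esub> (g \<otimes>\<^bsub>G\<^esub> x \<otimes>\<^bsub>G\<^esub> transpose_mat g)" using eq by simp
      also have "\<dots> = inv\<^bsub>G\<^esub> (transpose_mat g) \<otimes>\<^bsub>G\<^esub> (inv\<^bsub>G\<^esub> x \<otimes>\<^bsub>G\<^esub> inv\<^bsub>G\<^esub> g)"
        using gx gT by (simp add: inv_mult_group m_assoc)
      finally have "transpose_mat g \<otimes>\<^bsub>G\<^esub> inv\<^bsub>G\<^esub> x \<otimes>\<^bsub>G\<^esub> g
          = transpose_mat g \<otimes>\<^bsub>G\<^esub> (inv\<^bsub>G\<^esub> (transpose_mat g) \<otimes>\<^bsub>G\<^esub> (inv\<^bsub>G\<^esub> x \<otimes>\<^bsub>G\<^esub> inv\<^bsub>G\<^esub> g)) \<otimes>\<^bsub>G\<^esub> g"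
        by (rule arg_cong[where f = "\<lambda>z. transpose_mat g \<otimes>\<^bsub>G\<^esub> z \<otimes>\<^bsub>G\<^esub> g"])
      also have "\<dots> = inv\<^bsub>G\<^esub> x" using gx gT by (simp add: m_assoc cancel)
      finally show ?thesis .
    qed
    then have "transpose_mat g * inv\<^bsub>G\<^esub> x * g = inv\<^bsub>G\<^esub> x" by (simp add: G_def mult_GL)
    then show ?thesis
      using ex_self_recip_decomp_isometry[of g n "inv\<^bsub>G\<^esub> x"] gx by (auto simp: G_def[symmetric] chains_def)
  qed
  \<comment> \<open>Any choice of chain will do: equal chosen chains already give isomorphic
    modules.\<close>
  define ch where "ch g = (SOME ms. ms \<in> chains n \<and> endomorphism.decomp smult (mact g) ms (polys_below n))" for g :: "'a mat"
  have ch: "ch g \<in> chains n" "endomorphism.decomp smult (mact g) (ch g) (polys_below n)" if "g \<in> E" for g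
    using someI_ex[OF chain[OF that]] by (simp_all add: ch_def)
  have "k_GL_tau TYPE('a) n \<le> card (orbits G E ?c)"
    using k_GL_tau_le_twisted_classes[where 'a = 'a and n = n] card_twisted_classes[OF fin, of ?\<sigma>]
      inv_transpose_hom[where 'a = 'a and n = n] by (simp add: E_def flip: G_def)
  also have "card (orbits G E ?c) \<le> card (ch ` E)"
    unfolding orbits_eq_image
  proof (rule card_image_le_if_factors)
    fix g g' assume gg: "g \<in> E" "g' \<in> E" "ch g = ch g'"
    then have carr: "g \<in> carrier G" "g' \<in> carrier G" by (auto simp: E_def)
    have "\<exists>P\<in>carrier G. P * g = g' * P"
      unfolding G_def
      by (rule similar_if_decomp[of _ _ "ch g"])
        (use carr ch[OF gg(1)] ch[OF gg(2)] gg(3) in \<open>auto simp: G_def carrier_GL_iff\<close>)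
    then obtain P where P: "P \<in> carrier G" "P \<otimes>\<^bsub>G\<^esub> g = g' \<otimes>\<^bsub>G\<^esub> P" by (auto simp: G_def mult_GL)
    then have "P \<otimes>\<^bsub>G\<^esub> g \<otimes>\<^bsub>G\<^esub> inv\<^bsub>G\<^esub> P = g'" using carr by (simp add: m_assoc)
    then show "orbit G ?c g = orbit G ?c g'" using orbit_conj_eq[OF P(1) carr(1)] by simp
  qed (use finite_subset[OF _ finite_chains] ch(1) in blast)
  also have "card (ch ` E) \<le> card (chains n :: 'a poly list set)"
    using ch(1) by (intro card_mono finite_chains) blast
  finally show ?thesis .
qed

theorem theorem9p4:
  fixes q n :: nat
  assumes "CARD('a::{field,finite}) = q" and "n \<ge> 1"
  shows "(even q \<longrightarrow> k_GL_tau TYPE('a) n \<le> 28 * q ^ (n div 2)) \<and>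
         (odd q \<longrightarrow> k_GL_tau TYPE('a) n \<le> 23 * q ^ (n div 2))"
proof (intro conjI impI)
  note le = k_GL_tau_le_card_chains[where 'a = 'a and n = n]
  show "k_GL_tau TYPE('a) n \<le> 28 * q ^ (n div 2)" if "even q"
    using le card_chains_even[OF assms(2), where 'a = 'a] that unfolding assms(1) by (meson le_trans)
  show "k_GL_tau TYPE('a) n \<le> 23 * q ^ (n div 2)" if "odd q"
    using le card_chains_odd[OF assms(2), where 'a = 'a] that unfolding assms(1) by (meson le_trans)
qed

end
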